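(* Let $m>n\geq1$ be integers and let $\psi$ be an approximating function. Then \[ |W_0(m,n;\psi)|_{mn}= \begin{cases} 0 & \text{if } \sum_{r=1}^{\infty}\psi(r)^{n}r^{m-n-1}<\infty,\\ 1 & \text{if } \sum_{r=1}^{\infty}\psi(r)^{n}r^{m-n-1}=\infty. \end{cases} \]
   Context: An approximating function is a decreasing function $\psi:\mathbb{R}^+\to\mathbb{R}^+$ with $\psi(r)\to 0$ as $r\to\infty$. $\mathbb{I}^{mn}:=[-\tfrac12,\tfrac12]^{mn}$, and its points are regarded as $m\times n$ matrices $X$. For a vector, $|\cdot|$ denotes the supremum norm; for $\mathbf{q}\in\mathbb{Z}^m$ (a row vector), $\mathbf{q}X\in\mathbb{R}^n$ is the vector-matrix product. Define \[ W_0(m,n;\psi):=\{X\in\mathbb{I}^{mn}: |\mathbf{q}X|<\psi(|\mathbf{q}|)\text{ for infinitely many }\mathbf{q}\in\mathbb{Z}^m\setminus\{\mathbf{0}\}\}. \] For a set $A$, $|A|_k$ denotes its $k$-dimensional Lebesgue measure. *)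

theory Defs
  imports "HOL-Analysis.Analysis"
begin

definition approximating_function :: "(real \<Rightarrow> real) \<Rightarrow> bool" where
  "approximating_function \<psi> \<longleftrightarrow>
     (\<forall>r>0. \<psi> r > 0) \<and> antimono_on {0<..} \<psi> \<and> (\<psi> \<longlongrightarrow> 0) at_top"

definition real_vec :: "int ^ 'm \<Rightarrow> real ^ 'm" where
  "real_vec q = (\<chi> i. of_int (q $ i))"

text \<open>An \<open>m \<times> n\<close> matrix has type \<open>real ^ 'n ^ 'm\<close> with \<open>m = CARD('m)\<close> and \<open>n = CARD('n)\<close>;
  \<open>q v* X\<close> is the product of the row vector \<open>q\<close> with \<open>X\<close>, and \<open>infnorm\<close> is the supremum norm.\<close>

definition unit_cube :: "(real ^ 'n ^ 'm) set" where
  "unit_cube = {X. \<forall>i j. X $ i $ j \<in> {-1/2..1/2}}"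

definition W0 :: "(real \<Rightarrow> real) \<Rightarrow> (real ^ 'n::finite ^ 'm::finite) set" where
  "W0 \<psi> = {X \<in> unit_cube.
     infinite {q :: int ^ 'm. q \<noteq> 0 \<and> infnorm (real_vec q v* X) < \<psi> (infnorm (real_vec q))}}"

text \<open>Measurability of \<open>W0\<close> matters because \<open>emeasure\<close> is \<open>0\<close> by convention on non-measurable sets.\<close>

lemma countable_UNIV_int_vec: "countable (UNIV :: (int ^ 'm::finite) set)"
proof -
  have "countable (PiE (UNIV :: 'm set) (\<lambda>_. UNIV :: int set))"
    by (rule countable_PiE) auto
  then have "countable (range (vec_lambda :: ('m \<Rightarrow> int) \<Rightarrow> int ^ 'm))"
    by (intro countable_image) (simp add: PiE_UNIV_domain)
  moreover have "range (vec_lambda :: ('m \<Rightarrow> int) \<Rightarrow> int ^ 'm) = UNIV"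
    by (rule surjI[of _ vec_nth]) (rule vec_nth_inverse)
  ultimately show ?thesis by simp
qed

lemma W0_measurable: "(W0 \<psi> :: (real ^ 'n::finite ^ 'm::finite) set) \<in> sets lebesgue"
proof -
  define P where "P = (\<lambda>(q :: int ^ 'm) (X :: real ^ 'n ^ 'm).
     q \<noteq> 0 \<and> infnorm (real_vec q v* X) < \<psi> (infnorm (real_vec q)))"
  define F where "F = {G :: (int ^ 'm) set. finite G}"
  have P: "{X. P q X} \<in> sets borel" for q
  proof -
    have "continuous_on UNIV (\<lambda>X :: real ^ 'n ^ 'm. real_vec q v* X)"
      unfolding vector_matrix_mult_def by (intro continuous_intros)
    then have "continuous_on UNIV (\<lambda>X :: real ^ 'n ^ 'm. infnorm (real_vec q v* X))"
      by (intro continuous_intros)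
    then have "open {X :: real ^ 'n ^ 'm. infnorm (real_vec q v* X) < \<psi> (infnorm (real_vec q))}"
      by (intro open_Collect_less) auto
    then show ?thesis
      unfolding P_def by (cases "q = 0") auto
  qed
  have F: "countable F"
    unfolding F_def using countable_Collect_finite_subset[OF countable_UNIV_int_vec] by simp
  have "closed (unit_cube :: (real ^ 'n ^ 'm) set)"
    unfolding unit_cube_def atLeastAtMost_iff
    by (intro closed_Collect_all closed_Collect_conj closed_Collect_le continuous_intros)
  moreover have "W0 \<psi> = unit_cube \<inter> (\<Inter>G\<in>F. \<Union>q\<in>-G. {X. P q X})"
  proof -
    have "infinite {q. P q X} \<longleftrightarrow> (\<forall>G\<in>F. \<exists>q\<in>-G. P q X)" for X
    proof
      assume "infinite {q. P q X}"
      show "\<forall>G\<in>F. \<exists>q\<in>-G. P q X"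
      proof (intro ballI)
        fix G assume "G \<in> F"
        then have "\<not> {q. P q X} \<subseteq> G"
          using \<open>infinite {q. P q X}\<close> finite_subset unfolding F_def by auto
        then show "\<exists>q\<in>-G. P q X" by blast
      qed
    next
      assume *: "\<forall>G\<in>F. \<exists>q\<in>-G. P q X"
      show "infinite {q. P q X}"
      proof
        assume "finite {q. P q X}"
        then have "{q. P q X} \<in> F" unfolding F_def by simp
        from bspec[OF * this] show False by simp
      qed
    qed
    moreover have "W0 \<psi> = {X \<in> unit_cube. infinite {q. P q X}}"
      unfolding W0_def P_def by (rule refl)
    ultimately show ?thesis by (intro set_eqI) simp
  qed
  moreover have "(\<Union>q\<in>-G. {X. P q X}) \<in> sets borel" for G
    using P by (intro sets.countable_UN' countable_subset[OF subset_UNIV countable_UNIV_int_vec])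
      auto
  then have "(\<Inter>G\<in>F. \<Union>q\<in>-G. {X. P q X}) \<in> sets borel"
    using F by (intro sets.countable_INT') (auto simp: F_def)
  ultimately have "W0 \<psi> \<in> sets (borel :: (real ^ 'n ^ 'm) measure)"
    using borel_closed sets.Int by metis
  then show ?thesis by simp
qed

end

theory Submission
  imports Defs "HOL-Computational_Algebra.Polynomial"
begin

text \<open>
  The height of an integer vector is its supremum norm, \<open>m\<close> is the number of rows and \<open>n\<close> the number
  of columns of \<open>X\<close>.

  \<^bold>\<open>Convergence.\<close> For \<open>q \<noteq> 0\<close> of height \<open>r\<close>, the matrices of a fixed box with \<open>|q X| \<le> h\<close> have measure
  \<open>O ((h / r)\<^sup>n)\<close>: choose \<open>i\<close> with \<open>|q\<^sub>i| = r\<close> and vary only the \<open>i\<close>-th row. There are \<open>O (r\<^sup>m\<^sup>-\<^sup>1)\<close> vectors of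
  height \<open>r\<close>, so the given series dominates the sum of these measures, and the Borel-Cantelli lemma
  applies (\<open>AE_finitely_many_small_forms_vanishing\<close>).

  \<^bold>\<open>Divergence.\<close> Fix one row index \<open>a\<close>, freeze all other rows, and let the row \<open>y \<in> \<real>\<^sup>n\<close> with index \<open>a\<close>
  vary. If \<open>q\<^sub>a \<noteq> 0\<close>, the condition \<open>|q X| < \<psi> (|q|)\<close> then says that \<open>y\<close> is close to the point
  \<open>- (q X\<^sub>0) / q\<^sub>a\<close>, where \<open>X\<^sub>0\<close> is \<open>X\<close> with that row replaced by \<open>0\<close>. So each fibre is a problem about
  approximating points of \<open>\<real>\<^sup>n\<close> by points of a countable set, as in Khintchine's theorem, and it is
  treated by ubiquity:

    \<^item> By the pigeonhole principle (\<open>exists_short_form\<close>) every \<open>X\<close> in a bounded set has, for \<open>N = 2\<^sup>j\<^sup>n\<close>,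
      a form \<open>q \<noteq> 0\<close> of height at most \<open>N\<close> with \<open>|q X| \<le> \<delta>\<close>, where \<open>\<delta>\<close> is a constant times \<open>N\<^sup>1\<^sup>-\<^sup>m\<^sup>/\<^sup>n\<close>.

    \<^item> For almost all choices of the frozen rows, and for a suitable \<open>\<epsilon>\<close>, at least half of a given ball
      consists of rows \<open>y\<close> for which this \<open>q\<close> has \<open>|q\<^sub>a| > \<epsilon> N\<close>. The case \<open>q\<^sub>a = 0\<close> is excluded by the
      convergence argument applied to forms without the coordinate \<open>a\<close>; the case \<open>0 < |q\<^sub>a| \<le> \<epsilon> N\<close> is
      bounded by counting lattice points, which is possible because \<open>m > n\<close> and some \<open>n\<close> of the frozen
      rows are linearly independent (\<open>measure_small_coordinate_set_le\<close>).

    \<^item> Consequently balls of radius \<open>\<rho> = O (\<delta> / N)\<close> around the points with \<open>|q\<^sub>a| > \<epsilon> N\<close> cover half of the ball.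
      A well separated subfamily of the points is spread so evenly that the unions of the shrunken balls
      of radius \<open>\<psi> (N) / N\<close> are pairwise almost independent. A second moment estimate shows that their
      limit superior fills a fixed proportion of the ball, depending on \<open>n\<close> only
      (\<open>measure_limsup_balls_ge\<close>).

    \<^item> Since this holds in every ball, the fibre has full measure (\<open>AE_of_uniform_lower_density\<close>), and
      full measure of almost all fibres gives full measure (\<open>AE_of_AE_translates\<close>).

  In the ubiquity step the sum that has to diverge is \<open>\<Sum>\<^sub>j \<psi> (N\<^sub>j)\<^sup>n N\<^sub>j\<^sup>m\<^sup>-\<^sup>n\<close>, the condensed form of the given
  series. Monotonicity of \<open>\<psi>\<close> enters in this condensation and in the step from \<open>|q X| < \<psi> (N)\<close> to
  \<open>|q X| < \<psi> (|q|)\<close> for \<open>|q| \<le> N\<close>.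
\<close>

section \<open>Full measure from a lower density bound\<close>

lemma fmeasurable_ball_lborel [simp, intro]: "ball x r \<in> fmeasurable lborel"
  using emeasure_lborel_ball_finite[of x r] by (auto simp: fmeasurable_def)

text \<open>
  The complement \<open>S\<close> of \<open>U\<close> fills at most the proportion \<open>1 - c\<close> of every ball. By the Vitali covering
  theorem an open set \<open>T\<close> around \<open>S\<close> contains disjoint balls that cover almost all of \<open>S\<close>, so
  \<open>|S| \<le> (1 - c) |T|\<close>. As \<open>|T|\<close> can be made arbitrarily close to \<open>|S|\<close>, this forces \<open>|S| = 0\<close>.
\<close>

lemma AE_of_uniform_lower_density:
  fixes U :: "'a::euclidean_space set"
  assumes U: "U \<in> sets borel" and c: "c > 0"
    and dens: "\<And>x r. 0 < r \<Longrightarrow> r \<le> 1 \<Longrightarrow>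
      measure lborel (U \<inter> ball x r) \<ge> c * measure lborel (ball x r)"
  shows "AE x in lborel. x \<in> U"
proof -
  have c1: "c \<le> 1"
  proof -
    have pos: "measure lborel (ball (0::'a) 1) > 0"
      by (simp add: content_ball_pos)
    have "c * measure lborel (ball (0::'a) 1) \<le> measure lborel (U \<inter> ball 0 1)"
      by (rule dens) auto
    also have "\<dots> \<le> measure lborel (ball (0::'a) 1)"
      by (intro measure_mono_fmeasurable) (use U in \<open>auto\<close>)
    finally show ?thesis using pos by simp
  qed
  \<comment> \<open>Cutting the complement down to a ball makes its measure finite, so that it can be compared
    with the measure of an open neighbourhood.\<close>
  have null: "emeasure lborel (ball 0 (real k) - U) = 0" for k
  proof -
    define S where "S = ball (0::'a) (real k) - U"
    have S[measurable]: "S \<in> sets borel" using U by (auto simp: S_def)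
    have Sfin: "emeasure lborel S < \<infinity>"
    proof -
      have "emeasure lborel S \<le> emeasure lborel (ball (0::'a) (real k))"
        by (intro emeasure_mono) (auto simp: S_def)
      then show ?thesis using emeasure_lborel_ball_finite le_less_trans by blast
    qed
    have small: "emeasure lborel S \<le> ennreal (1 - c) * emeasure lborel T" if "open T" "S \<subseteq> T" for T
    proof -
      define K where "K = {p :: 'a \<times> real. 0 < snd p \<and> snd p \<le> 1 \<and> ball (fst p) (snd p) \<subseteq> T}"
      have cov: "\<exists>p. p \<in> K \<and> x \<in> ball (fst p) (snd p) \<and> snd p < d" if "x \<in> S" "0 < d" for x d
      proof -
        have "x \<in> T" using that \<open>S \<subseteq> T\<close> by auto
        then obtain e where e: "e > 0" "ball x e \<subseteq> T" using \<open>open T\<close> open_contains_ball by blast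
        define s where "s = min (min e 1) (d/2)"
        have "0 < s" "s \<le> e" "s \<le> 1" "s < d" using e that by (auto simp: s_def)
        then have "(x, s) \<in> K" using e subset_ball[of s e x] by (auto simp: K_def)
        then show ?thesis using \<open>s < d\<close> \<open>0 < s\<close> by (intro exI[of _ "(x, s)"]) auto
      qed
      obtain C where C: "countable C" "C \<subseteq> K"
        "pairwise (\<lambda>i j. disjnt (ball (fst i) (snd i)) (ball (fst j) (snd j))) C"
        "negligible (S - (\<Union>i \<in> C. ball (fst i) (snd i)))"
        using Vitali_covering_theorem_balls[of S K fst snd] cov by blast
      let ?B = "\<lambda>i::'a \<times> real. ball (fst i) (snd i)"
      have disj: "disjoint_family_on ?B C"
        using C(3) by (auto simp: disjoint_family_on_def pairwise_def disjnt_def)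
      have UB[measurable]: "(\<Union>i\<in>C. ?B i) \<in> sets borel" by (intro borel_open) auto
      have N: "S - (\<Union>i\<in>C. ?B i) \<in> null_sets lborel"
        using C(4) S by (simp add: negligible_iff_null_sets null_sets_completion_iff)
      have "emeasure lborel S = emeasure lborel (S \<inter> (\<Union>i\<in>C. ?B i))"
      proof -
        have "S = (S \<inter> (\<Union>i\<in>C. ?B i)) \<union> (S - (\<Union>i\<in>C. ?B i))" by auto
        then show ?thesis using emeasure_Un_null_set[OF _ N, of "S \<inter> (\<Union>i\<in>C. ?B i)"]
          by (metis S UB sets.Int sets_lborel)
      qed
      also have "S \<inter> (\<Union>i\<in>C. ?B i) = (\<Union>i\<in>C. S \<inter> ?B i)" by auto
      also have "emeasure lborel \<dots> = (\<integral>\<^sup>+i. emeasure lborel (S \<inter> ?B i) \<partial>count_space C)"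
      proof (intro emeasure_UN_countable)
        show "disjoint_family_on (\<lambda>i. S \<inter> ?B i) C"
          by (rule disjoint_family_on_bisimulation[OF disj]) blast
      qed (use C(1) in auto)
      also have "\<dots> \<le> (\<integral>\<^sup>+i. ennreal (1 - c) * emeasure lborel (?B i) \<partial>count_space C)"
      proof (intro nn_integral_mono)
        fix i assume "i \<in> space (count_space C)"
        then have "i \<in> K" using C by auto
        then have i: "0 < snd i" "snd i \<le> 1" by (auto simp: K_def)
        have "measure lborel (S \<inter> ?B i) \<le> measure lborel (?B i - U)"
          by (intro measure_mono_fmeasurable) (use U in \<open>auto simp: S_def intro!: fmeasurable_Diff\<close>)
        also have "?B i - U = ?B i - (U \<inter> ?B i)" by auto
        also have "measure lborel \<dots> = measure lborel (?B i) - measure lborel (U \<inter> ?B i)"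
          by (intro measure_Diff) (use U emeasure_lborel_ball_finite[of "fst i" "snd i"] in \<open>auto\<close>)
        also have "\<dots> \<le> (1 - c) * measure lborel (?B i)"
          using dens[OF i, of "fst i"] by (simp add: algebra_simps)
        finally have *: "measure lborel (S \<inter> ?B i) \<le> (1 - c) * measure lborel (?B i)" .
        have fin: "emeasure lborel (?B i) \<noteq> \<infinity>"
          using emeasure_lborel_ball_finite[of "fst i" "snd i"] by auto
        have fin2: "emeasure lborel (S \<inter> ?B i) \<noteq> \<infinity>"
          using fin emeasure_mono[of "S \<inter> ?B i" "?B i" lborel] by (auto simp: top_unique)
        have "emeasure lborel (S \<inter> ?B i) = ennreal (measure lborel (S \<inter> ?B i))"
          using fin2 by (simp add: emeasure_eq_ennreal_measure)
        also have "\<dots> \<le> ennreal ((1 - c) * measure lborel (?B i))" using * by (rule ennreal_leI)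
        also have "\<dots> = ennreal (1 - c) * emeasure lborel (?B i)"
          using fin c1 by (simp add: emeasure_eq_ennreal_measure ennreal_mult)
        finally show "emeasure lborel (S \<inter> ?B i) \<le> ennreal (1 - c) * emeasure lborel (?B i)" .
      qed
      also have "\<dots> = ennreal (1 - c) * (\<integral>\<^sup>+i. emeasure lborel (?B i) \<partial>count_space C)"
        by (rule nn_integral_cmult) auto
      also have "(\<integral>\<^sup>+i. emeasure lborel (?B i) \<partial>count_space C) = emeasure lborel (\<Union>i\<in>C. ?B i)"
        using disj C(1) by (intro emeasure_UN_countable[symmetric]) auto
      also have "ennreal (1 - c) * \<dots> \<le> ennreal (1 - c) * emeasure lborel T"
        using C(2) \<open>open T\<close> by (intro mult_left_mono emeasure_mono) (auto simp: K_def)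
      finally show ?thesis .
    qed
    define s where "s = measure lborel S"
    have s: "emeasure lborel S = ennreal s" 
      using Sfin by (simp add: s_def emeasure_eq_ennreal_measure)
    have "s \<le> 0"
    proof (rule ccontr)
      assume "\<not> s \<le> 0"
      then have "s > 0" by simp
      \<comment> \<open>The margin c * s is small enough because (1 - c) * (1 + c) < 1.\<close>
      obtain T where T: "open T" "S \<subseteq> T" "emeasure lebesgue (T - S) < ennreal (c * s)"
        using sets_lebesgue_outer_open[of S "c * s"] S c \<open>s > 0\<close>
        by (metis lmeasurable_iff_integrable mult_pos_pos sets_completionI_sets sets_lborel)
      have "emeasure lborel T \<le> emeasure lborel S + emeasure lborel (T - S)"
      proof -
        have "T = S \<union> (T - S)" using T by auto
        then show ?thesis using emeasure_subadditive[of S lborel "T - S"] S T(1) by auto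
      qed
      also have "emeasure lborel (T - S) = emeasure lebesgue (T - S)"
        using S T(1) by simp
      also have "emeasure lborel S + \<dots> < ennreal s + ennreal (c * s)"
        using T(3) s by (simp add: ennreal_add_left_cancel_less)
      finally have lt: "emeasure lborel T < ennreal (s + c * s)"
        using \<open>s > 0\<close> c by (simp add: ennreal_plus)
      define t where "t = measure lborel T"
      have t: "emeasure lborel T = ennreal t"
        unfolding t_def by (rule emeasure_eq_ennreal_measure) (use lt in auto)
      have "t < s + c * s" using lt unfolding t by (subst (asm) ennreal_less_iff) (auto simp: t_def)
      have "ennreal s \<le> ennreal ((1 - c) * t)"
        using small[OF T(1,2)] c1 unfolding s t by (simp add: ennreal_mult t_def)
      then have "s \<le> (1 - c) * t" 
        using \<open>s > 0\<close> by (metis ennreal_le_iff2 not_le)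
      also have "\<dots> \<le> (1 - c) * (s + c * s)"
        using \<open>t < s + c * s\<close> c1 by (intro mult_left_mono) auto
      also have "\<dots> = s - c * c * s" by (simp add: algebra_simps)
      also have "\<dots> < s" using c \<open>s > 0\<close> by simp
      finally show False by simp
    qed
    then show ?thesis using s unfolding S_def by (simp add: ennreal_neg)
  qed
  have "AE x in lborel. \<forall>k. x \<notin> ball 0 (real k) - U"
    unfolding AE_all_countable
  proof
    fix k
    have "ball 0 (real k) - U \<in> null_sets lborel" using null U by (auto simp: null_sets_def)
    then show "AE x in lborel. x \<notin> ball 0 (real k) - U" by (rule AE_not_in)
  qed
  then show ?thesis
  proof (eventually_elim)
    fix x :: 'a assume *: "\<forall>k. x \<notin> ball 0 (real k) - U"
    obtain k :: nat where "norm x < real k" using reals_Archimedean2 by blast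
    with * show "x \<in> U" by auto
  qed
qed

section \<open>The limit superior of unions of small balls\<close>

lemma fmeasurable_cball_lborel [simp, intro]: "cball x r \<in> fmeasurable lborel"
  using emeasure_lborel_cball_finite[of x r] by (auto simp: fmeasurable_def)

text \<open>
  The Cauchy-Schwarz bound \<open>|\<Union> E\<^sub>i| \<ge> (\<Sum> |E\<^sub>i|)\<^sup>2 / \<Sum>\<Sum> |E\<^sub>i \<inter> E\<^sub>j|\<close> is the optimum over \<open>t\<close> of this
  inequality, which holds because it is the integral of the pointwise inequality
  \<open>2 t f - t\<^sup>2 f\<^sup>2 \<le> 1\<close> on the union, where \<open>f\<close> counts the sets \<open>E\<^sub>i\<close> containing a point.
\<close>

lemma measure_Union_ge_second_moment:
  assumes fin: "finite F" and E: "\<And>i. i \<in> F \<Longrightarrow> E i \<in> fmeasurable M"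
  shows "2 * t * (\<Sum>i\<in>F. measure M (E i)) - t\<^sup>2 * (\<Sum>i\<in>F. \<Sum>j\<in>F. measure M (E i \<inter> E j))
           \<le> measure M (\<Union>i\<in>F. E i)"
proof -
  define f where "f = (\<lambda>x. \<Sum>i\<in>F. indicator (E i) x :: real)"
  have Eij: "E i \<inter> E j \<in> fmeasurable M" if "i \<in> F" "j \<in> F" for i j
    using that E by (intro fmeasurable_Int_fmeasurable) (auto dest: fmeasurableD)
  have U: "(\<Union>i\<in>F. E i) \<in> fmeasurable M" using fin E by (intro fmeasurable.finite_UN) auto
  have ind: "integrable M (indicator A :: _ \<Rightarrow> real)" "(\<integral>x. indicator A x \<partial>M) = measure M A"
    if "A \<in> fmeasurable M" for A
    using that by (auto simp: fmeasurable_def)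
  have f2: "f x * f x = (\<Sum>i\<in>F. \<Sum>j\<in>F. indicator (E i \<inter> E j) x)" for x
    by (simp add: f_def sum_product indicator_inter_arith)
  have i1: "integrable M f" unfolding f_def using E ind(1) by (intro Bochner_Integration.integrable_sum) auto
  have i2: "integrable M (\<lambda>x. f x * f x)" unfolding f2
    using Eij ind(1) by (intro Bochner_Integration.integrable_sum) auto
  have "(\<integral>x. 2 * t * f x - t\<^sup>2 * (f x * f x) \<partial>M) \<le> (\<integral>x. indicator (\<Union>i\<in>F. E i) x \<partial>M)"
  proof (intro integral_mono)
    fix x
    show "2 * t * f x - t\<^sup>2 * (f x * f x) \<le> indicator (\<Union>i\<in>F. E i) x"
    proof (cases "x \<in> (\<Union>i\<in>F. E i)")
      case True
      have "0 \<le> (1 - t * f x)\<^sup>2" by simp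
      also have "\<dots> = 1 - (2 * t * f x - t\<^sup>2 * (f x * f x))"
        by (simp add: power2_eq_square algebra_simps)
      finally show ?thesis using True by simp
    next
      case False
      then have "f x = 0" by (auto simp: f_def)
      then show ?thesis by simp
    qed
  qed (use i1 i2 ind[OF U] in auto)
  also have "(\<integral>x. 2 * t * f x - t\<^sup>2 * (f x * f x) \<partial>M) = 2 * t * (\<integral>x. f x \<partial>M) - t\<^sup>2 * (\<integral>x. f x * f x \<partial>M)"
    using i1 i2 by simp
  also have "(\<integral>x. f x \<partial>M) = (\<Sum>i\<in>F. measure M (E i))"
    unfolding f_def using E ind by (subst Bochner_Integration.integral_sum) auto
  also have "(\<integral>x. f x * f x \<partial>M) = (\<Sum>i\<in>F. \<Sum>j\<in>F. measure M (E i \<inter> E j))"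
  proof -
    have "integrable M (\<lambda>x. \<Sum>j\<in>F. indicator (E i \<inter> E j) x :: real)" if "i \<in> F" for i
      using that Eij ind(1) by (intro Bochner_Integration.integrable_sum) auto
    then have "(\<integral>x. f x * f x \<partial>M) = (\<Sum>i\<in>F. \<integral>x. (\<Sum>j\<in>F. indicator (E i \<inter> E j) x) \<partial>M)"
      unfolding f2 by (rule Bochner_Integration.integral_sum)
    also have "\<dots> = (\<Sum>i\<in>F. \<Sum>j\<in>F. \<integral>x. indicator (E i \<inter> E j) x \<partial>M)"
      using Eij ind(1) by (intro sum.cong refl Bochner_Integration.integral_sum) auto
    also have "\<dots> = (\<Sum>i\<in>F. \<Sum>j\<in>F. measure M (E i \<inter> E j))"
      using Eij ind(2) by (intro sum.cong refl) auto
    finally show ?thesis .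
  qed
  finally show ?thesis using ind[OF U] by simp
qed

lemma measure_ball_lborel:
  fixes x :: "'a::euclidean_space"
  assumes "0 \<le> r"
  shows "measure lborel (ball x r) = unit_ball_vol (DIM('a)) * r ^ DIM('a)"
    and "measure lborel (cball x r) = unit_ball_vol (DIM('a)) * r ^ DIM('a)"
  using content_ball[OF assms, of x] content_cball[OF assms, of x] by simp_all

lemma card_disjoint_cballs_le:
  fixes y :: "'a::euclidean_space"
  assumes fin: "finite G" and dis: "pairwise (\<lambda>p q. disjnt (cball p \<rho>) (cball q \<rho>)) G"
    and sub: "\<And>p. p \<in> G \<Longrightarrow> cball p \<rho> \<subseteq> ball y s" and pos: "0 \<le> \<rho>" "0 \<le> s"
  shows "real (card G) * \<rho> ^ DIM('a) \<le> s ^ DIM('a)"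
proof -
  have disj: "disjoint_family_on (\<lambda>p. cball p \<rho>) G"
    using dis by (auto simp: disjoint_family_on_def pairwise_def disjnt_def)
  have "(\<Sum>p\<in>G. measure lborel (cball p \<rho>)) = measure lborel (\<Union>p\<in>G. cball p \<rho>)"
    using fin disj by (intro measure_finite_Union[symmetric])
      (use emeasure_lborel_cball_finite in \<open>auto simp: less_top[symmetric]\<close>)
  also have "\<dots> \<le> measure lborel (ball y s)"
    using sub fin by (intro measure_mono_fmeasurable) auto
  finally have "unit_ball_vol (DIM('a)) * (real (card G) * \<rho> ^ DIM('a))
      \<le> unit_ball_vol (DIM('a)) * s ^ DIM('a)"
    using pos by (simp add: measure_ball_lborel algebra_simps)
  then show ?thesis by (simp add: unit_ball_vol_pos)
qed

text \<open>
  If balls of radius \<open>\<rho>\<close> around \<open>P\<close> cover half of a ball, then \<open>P\<close> contains \<open>2 \<rho>\<close>-separated points in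
  number comparable to \<open>(R / \<rho>)\<close> to the power of the dimension, the largest number possible. They are
  chosen by the Vitali covering lemma: enlarging the selected balls by the factor \<open>5\<close> recovers all
  others. Half the radius is used for covering so that the selected balls stay inside \<open>ball x0 R\<close>.
\<close>

lemma exists_separated_centres:
  fixes x0 :: "'a::euclidean_space"
  assumes P: "countable P" and \<rho>: "0 < \<rho>" "4 * \<rho> < R"
    and cov: "measure lborel (ball x0 (R/2)) / 2
       \<le> measure lborel (ball x0 (R/2) \<inter> (\<Union>p\<in>P. cball p \<rho>))"
  shows "\<exists>S. finite S \<and> S \<subseteq> P \<and> (\<forall>p\<in>S. cball p \<rho> \<subseteq> ball x0 R)
     \<and> pairwise (\<lambda>p q. disjnt (cball p \<rho>) (cball q \<rho>)) S
     \<and> R ^ DIM('a) \<le> 2 * 10 ^ DIM('a) * (real (card S) * \<rho> ^ DIM('a))"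
proof -
  define K where "K = {p\<in>P. cball p \<rho> \<inter> ball x0 (R/2) \<noteq> {}}"
  obtain C where C: "countable C" "C \<subseteq> K"
     "pairwise (\<lambda>i j. disjnt (cball i \<rho>) (cball j \<rho>)) C"
     "\<And>i. i \<in> K \<Longrightarrow> \<exists>j. j \<in> C \<and> \<not> disjnt (cball i \<rho>) (cball j \<rho>) \<and> cball i \<rho> \<subseteq> ball j (5 * \<rho>)"
    using Vitali_covering_lemma_cballs_balls[of K "\<lambda>_. \<rho>" \<rho> "\<lambda>p. p"] \<rho> by blast
  have sub: "cball p \<rho> \<subseteq> ball x0 R" if "p \<in> K" for p
  proof
    fix z assume z: "z \<in> cball p \<rho>"
    from that obtain y where y: "dist p y \<le> \<rho>" "dist x0 y < R/2" by (auto simp: K_def)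
    have "dist x0 z \<le> dist x0 y + dist p y + dist p z"
      using dist_triangle[of x0 z y] dist_triangle[of y z p] by (simp add: dist_commute)
    then show "z \<in> ball x0 R" using y z \<rho> by simp
  qed
  have bd: "real (card G) * \<rho> ^ DIM('a) \<le> R ^ DIM('a)" if "finite G" "G \<subseteq> C" for G
    using that C(2,3) sub \<rho> by (intro card_disjoint_cballs_le) (auto intro: pairwise_subset)
  have finC: "finite C"
  proof (rule ccontr)
    assume inf: "infinite C"
    obtain k :: nat where k: "R ^ DIM('a) / \<rho> ^ DIM('a) < real k" using reals_Archimedean2 by blast
    obtain G where G: "finite G" "card G = k" "G \<subseteq> C"
      using infinite_arbitrarily_large[OF inf, of k] by blast
    from bd[OF G(1,3)] G(2) k \<rho> show False by (simp add: divide_less_eq)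
  qed
  have "measure lborel (ball x0 (R/2)) / 2 \<le> measure lborel (\<Union>p\<in>C. ball p (5 * \<rho>))"
  proof (rule order.trans[OF cov], intro measure_mono_fmeasurable)
    show "ball x0 (R / 2) \<inter> (\<Union>p\<in>P. cball p \<rho>) \<subseteq> (\<Union>p\<in>C. ball p (5 * \<rho>))"
    proof
      fix z assume z: "z \<in> ball x0 (R / 2) \<inter> (\<Union>p\<in>P. cball p \<rho>)"
      then obtain p where p: "p \<in> P" "z \<in> cball p \<rho>" by blast
      then have "p \<in> K" using z by (auto simp: K_def)
      from C(4)[OF this] p show "z \<in> (\<Union>p\<in>C. ball p (5 * \<rho>))" by blast
    qed
    show "ball x0 (R / 2) \<inter> (\<Union>p\<in>P. cball p \<rho>) \<in> sets lborel"
      using P by (intro sets.Int sets.countable_UN') auto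
  qed (use finC in auto)
  also have "\<dots> \<le> (\<Sum>p\<in>C. measure lborel (ball p (5 * \<rho>)))"
    using finC by (intro measure_UNION_le) auto
  also have "\<dots> = real (card C) * (unit_ball_vol (DIM('a)) * (5 * \<rho>) ^ DIM('a))"
    using \<rho> by (simp add: measure_ball_lborel)
  finally have "unit_ball_vol (DIM('a)) * ((R/2) ^ DIM('a) / 2)
      \<le> unit_ball_vol (DIM('a)) * (real (card C) * (5 * \<rho>) ^ DIM('a))"
    using \<rho> by (simp add: measure_ball_lborel algebra_simps)
  then have "(R/2) ^ DIM('a) / 2 \<le> real (card C) * (5 * \<rho>) ^ DIM('a)"
    by (simp add: unit_ball_vol_pos)
  then have "2 * 2 ^ DIM('a) * ((R/2) ^ DIM('a) / 2) \<le> 2 * 2 ^ DIM('a) * (real (card C) * (5 * \<rho>) ^ DIM('a))"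
    by (intro mult_left_mono) auto
  also have "2 * 2 ^ DIM('a) * ((R/2) ^ DIM('a) / 2) = R ^ DIM('a)"
    by (simp add: power_divide)
  also have "2 * 2 ^ DIM('a) * (real (card C) * (5 * \<rho>) ^ DIM('a)) = 2 * 10 ^ DIM('a) * (real (card C) * \<rho> ^ DIM('a))"
    using power_mult_distrib[of "2::real" "5" "DIM('a)"] by (simp add: power_mult_distrib)
  finally have "R ^ DIM('a) \<le> 2 * 10 ^ DIM('a) * (real (card C) * \<rho> ^ DIM('a))" .
  moreover have "C \<subseteq> P" "\<forall>p\<in>C. cball p \<rho> \<subseteq> ball x0 R" using C(2) sub by (auto simp: K_def)
  ultimately show ?thesis using finC C(3) by blast
qed

lemma sum_half_powers_le:
  fixes I :: "nat set"
  assumes "finite I"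
  shows "(\<Sum>i\<in>{i\<in>I. i \<le> j}. (1/2::real) ^ (j - i)) \<le> 2"
proof -
  have "(\<Sum>i\<in>{i\<in>I. i \<le> j}. (1/2::real) ^ (j - i)) \<le> (\<Sum>i\<in>{..j}. (1/2) ^ (j - i))"
    using assms by (intro sum_mono2) auto
  also have "\<dots> = (\<Sum>i\<in>{..j}. (1/2) ^ i)"
    by (rule sum.nat_diff_reindex[of "\<lambda>i. (1/2::real) ^ i" "Suc j", simplified lessThan_Suc_atMost diff_Suc_Suc])
  also have "\<dots> \<le> 2" by (simp add: sum_gp0)
  finally show ?thesis .
qed

text \<open>
  Packing estimate behind the near independence of different levels: a ball of radius \<open>r\<close> meets at most
  as many of the small balls around the separated points as its volume suggests, up to a constant factor
  and apart from a bounded number caused by its boundary.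
\<close>

lemma card_near_separated_le:
  fixes x :: "'a::euclidean_space"
  assumes S: "finite S" "pairwise (\<lambda>p q. disjnt (cball p \<rho>) (cball q \<rho>)) S"
    and \<rho>: "0 < \<rho>" "0 \<le> r'" "r' \<le> \<rho>" "0 \<le> r"
  shows "real (card {p'\<in>S. ball x r \<inter> ball p' r' \<noteq> {}}) * \<rho> ^ DIM('a)
    \<le> 6 ^ DIM('a) * (r ^ DIM('a) + \<rho> ^ DIM('a))"
proof -
  have "real (card {p'\<in>S. ball x r \<inter> ball p' r' \<noteq> {}}) * \<rho> ^ DIM('a) \<le> (r + 3 * \<rho>) ^ DIM('a)"
  proof (rule card_disjoint_cballs_le[where y = x])
    fix p' assume "p' \<in> {p'\<in>S. ball x r \<inter> ball p' r' \<noteq> {}}"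
    then obtain y where y: "dist x y < r" "dist p' y < r'" by auto
    show "cball p' \<rho> \<subseteq> ball x (r + 3 * \<rho>)"
    proof
      fix z assume "z \<in> cball p' \<rho>"
      then have "dist p' z \<le> \<rho>" by simp
      moreover have "dist x z \<le> dist x y + dist p' y + dist p' z"
        using dist_triangle[of x z y] dist_triangle[of y z p'] by (simp add: dist_commute)
      ultimately show "z \<in> ball x (r + 3 * \<rho>)" using y \<rho> by simp
    qed
  qed (use S \<rho> in \<open>auto intro: pairwise_subset\<close>)
  also have "\<dots> \<le> (6 * max r \<rho>) ^ DIM('a)"
    using \<rho> by (intro power_mono) auto
  also have "\<dots> \<le> 6 ^ DIM('a) * (r ^ DIM('a) + \<rho> ^ DIM('a))"
    using \<rho> by (auto simp: power_mult_distrib max_def)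
  finally show ?thesis .
qed

text \<open>
  The proportion delivered by the second moment method: \<open>1 / (2 * 10 ^ d)\<close> is the loss in the first
  moment, which enters squared, and \<open>5 * 6 ^ d\<close> the factor in the second moment.
\<close>

definition ubiquity_const :: "nat \<Rightarrow> real" where
  "ubiquity_const d = 1 / ((2 * 10 ^ d)\<^sup>2 * (5 * 6 ^ d))"

lemma ubiquity_const_pos: "ubiquity_const d > 0"
  by (simp add: ubiquity_const_def)

text \<open>
  The ubiquity principle. At level \<open>j\<close> choose separated points \<open>S\<^sub>j\<close> in \<open>P\<^sub>j\<close> and let \<open>E\<^sub>j\<close> be the union of
  the balls of radius \<open>r\<^sub>j\<close> around them. With \<open>w\<^sub>j = (r\<^sub>j / \<rho>\<^sub>j)\<^sup>d\<close> the measure of \<open>E\<^sub>j\<close> is comparable to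
  \<open>w\<^sub>j\<close> times the volume of the ball, and for \<open>i \<le> j\<close> the packing estimate bounds \<open>|E\<^sub>i \<inter> E\<^sub>j|\<close> by the
  independent value \<open>w\<^sub>i w\<^sub>j\<close> plus the boundary term \<open>2\<^sup>i\<^sup>-\<^sup>j w\<^sub>j\<close>, up to a constant. The geometric decay of
  \<open>\<rho>\<close> makes the boundary terms summable, so they contribute only a multiple of \<open>\<Sum> w\<^sub>j\<close>, which is
  at most its square once the sum reaches \<open>1\<close>.
\<close>

lemma measure_limsup_balls_ge:
  fixes x0 :: "'a::euclidean_space" and P :: "nat \<Rightarrow> 'a set"
  assumes P: "\<And>j. countable (P j)" and R: "0 < R"
    and \<rho>: "\<And>j. 0 < \<rho> j" "\<And>j. \<rho> (Suc j) \<le> \<rho> j / 2"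
    and r: "\<And>j. 0 < r j" "\<And>j. r j \<le> \<rho> j"
    and div: "\<not> summable (\<lambda>j. (r j / \<rho> j) ^ DIM('a))"
    and cov: "\<forall>\<^sub>F j in sequentially. measure lborel (ball x0 (R/2)) / 2
       \<le> measure lborel (ball x0 (R/2) \<inter> (\<Union>p\<in>P j. cball p (\<rho> j)))"
  shows "ubiquity_const DIM('a) * measure lborel (ball x0 R)
     \<le> measure lborel (ball x0 R \<inter> {x. \<exists>\<^sub>F j in sequentially. \<exists>p\<in>P j. x \<in> ball p (r j)})"
proof -
  define n where "n = DIM('a)"
  have n: "n > 0" by (simp add: n_def)
  define v where "v = unit_ball_vol (real DIM('a))"
  have v: "v > 0" by (simp add: v_def unit_ball_vol_pos)
  define V where "V = measure lborel (ball x0 R)"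
  have V: "V = v * R ^ n" "V > 0" using R v by (simp_all add: V_def measure_ball_lborel v_def n_def)
  define w where "w = (\<lambda>j. (r j / \<rho> j) ^ n)"
  have w: "0 \<le> w j" for j using \<rho>(1)[of j] r(1)[of j] by (simp add: w_def)
  have \<rho>_ratio: "\<rho> j \<le> \<rho> i * (1/2) ^ (j - i)" if "i \<le> j" for i j
    using that
  proof (induction j rule: dec_induct)
    case (step k)
    then have "\<rho> (Suc k) \<le> (\<rho> i * (1/2) ^ (k - i)) / 2" using \<rho>(2)[of k] by simp
    then show ?case using step by (simp add: Suc_diff_le)
  qed simp
  have "\<rho> \<longlonglongrightarrow> 0"
  proof (rule tendsto_sandwich[OF _ _ tendsto_const])
    show "\<forall>\<^sub>F j in sequentially. \<rho> j \<le> \<rho> 0 * (1/2) ^ j" using \<rho>_ratio[of 0] by simp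
    show "(\<lambda>j. \<rho> 0 * (1/2) ^ j) \<longlonglongrightarrow> 0"
      by (intro tendsto_mult_right_zero LIMSEQ_power_zero) simp
    show "\<forall>\<^sub>F j in sequentially. 0 \<le> \<rho> j" using \<rho>(1) by (intro always_eventually) (auto intro: less_imp_le)
  qed
  then have small: "\<forall>\<^sub>F j in sequentially. \<rho> j < R / 4" using R by (intro order_tendstoD(2)) auto
  define Sep where "Sep = (\<lambda>j S. finite S \<and> S \<subseteq> P j \<and> (\<forall>p\<in>S. cball p (\<rho> j) \<subseteq> ball x0 R)
     \<and> pairwise (\<lambda>p q. disjnt (cball p (\<rho> j)) (cball q (\<rho> j))) S
     \<and> R ^ n \<le> 2 * 10 ^ n * (real (card S) * \<rho> j ^ n))"
  have "\<forall>\<^sub>F j in sequentially. \<exists>S. Sep j S"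
    using small cov
  proof eventually_elim
    case (elim j)
    then show ?case
      unfolding Sep_def n_def using P[of j] \<rho>(1)[of j] by (intro exists_separated_centres) auto
  qed
  then obtain J0 where "\<And>j. j \<ge> J0 \<Longrightarrow> \<exists>S. Sep j S"
    by (auto simp: eventually_sequentially)
  then have "\<forall>j. \<exists>S. j \<ge> J0 \<longrightarrow> Sep j S" by blast
  then obtain S where S': "\<forall>j. j \<ge> J0 \<longrightarrow> Sep j (S j)" by (rule choice[THEN exE])
  have S: "\<And>j. j \<ge> J0 \<Longrightarrow> finite (S j)" "\<And>j. j \<ge> J0 \<Longrightarrow> S j \<subseteq> P j"
     "\<And>j p. j \<ge> J0 \<Longrightarrow> p \<in> S j \<Longrightarrow> cball p (\<rho> j) \<subseteq> ball x0 R"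
     "\<And>j. j \<ge> J0 \<Longrightarrow> pairwise (\<lambda>p q. disjnt (cball p (\<rho> j)) (cball q (\<rho> j))) (S j)"
     "\<And>j. j \<ge> J0 \<Longrightarrow> R ^ n \<le> 2 * 10 ^ n * (real (card (S j)) * \<rho> j ^ n)"
    using S' unfolding Sep_def by auto
  define E where "E = (\<lambda>j. \<Union>p\<in>S j. ball p (r j))"
  have Em: "E j \<in> fmeasurable lborel" if "j \<ge> J0" for j
    unfolding E_def using S(1)[OF that] by (intro fmeasurable.finite_UN) auto
  have Esub: "E j \<subseteq> ball x0 R" if "j \<ge> J0" for j
  proof -
    have "ball x (r j) \<subseteq> cball x (\<rho> j)" for x using r(2)[of j] by auto
    then show ?thesis using S(3)[OF that] unfolding E_def by blast
  qed
  have lower: "V * w j / (2 * 10 ^ n) \<le> measure lborel (E j)" if j: "j \<ge> J0" for j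
  proof -
    have disj: "disjoint_family_on (\<lambda>p. ball p (r j)) (S j)"
    proof (rule disjoint_family_on_bisimulation[where f = "\<lambda>p. cball p (\<rho> j)"])
      show "disjoint_family_on (\<lambda>p. cball p (\<rho> j)) (S j)"
        using S(4)[OF j] by (auto simp: disjoint_family_on_def pairwise_def disjnt_def)
      show "ball p (r j) \<inter> ball q (r j) = {}" if "cball p (\<rho> j) \<inter> cball q (\<rho> j) = {}" for p q
      proof -
        have "ball x (r j) \<subseteq> cball x (\<rho> j)" for x using r(2)[of j] by auto
        then show ?thesis using that by blast
      qed
    qed
    have "measure lborel (E j) = (\<Sum>p\<in>S j. measure lborel (ball p (r j)))"
      unfolding E_def using S(1)[OF j] disj emeasure_lborel_ball_finite
      by (intro measure_finite_Union) (auto simp: less_top[symmetric])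
    also have "\<dots> = real (card (S j)) * (v * r j ^ n)"
      using r(1)[of j] by (simp add: measure_ball_lborel v_def n_def)
    finally have e: "measure lborel (E j) = v * w j * (real (card (S j)) * \<rho> j ^ n)"
      using \<rho>(1)[of j] by (simp add: w_def power_divide)
    have "V * w j / (2 * 10 ^ n) = v * w j * (R ^ n / (2 * 10 ^ n))" using V by simp
    also have "\<dots> \<le> v * w j * (real (card (S j)) * \<rho> j ^ n)"
      using S(5)[OF j] v w[of j] by (intro mult_left_mono) (auto simp: divide_le_eq algebra_simps)
    finally show ?thesis using e by simp
  qed
  have inter: "measure lborel (E i \<inter> E j) \<le> V * 6 ^ n * (w i * w j + (1/2) ^ (j - i) * w j)"
    if i: "i \<ge> J0" and ij: "i \<le> j" for i j
  proof -
    have j: "j \<ge> J0" using i ij by simp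
    define N where "N = (\<lambda>p. {p'\<in>S j. ball p (r i) \<inter> ball p' (r j) \<noteq> {}})"
    have finN: "finite (N p)" for p using S(1)[OF j] by (simp add: N_def)
    have cardN: "real (card (N p)) * r j ^ n \<le> 6 ^ n * (r i ^ n + \<rho> j ^ n) * w j" for p
    proof -
      have "real (card (N p)) * \<rho> j ^ n \<le> 6 ^ n * (r i ^ n + \<rho> j ^ n)"
        unfolding N_def n_def using S(1,4)[OF j] \<rho>(1)[of j] r(1)[of j] r(2)[of j] r(1)[of i]
        by (intro card_near_separated_le) auto
      then have "real (card (N p)) * \<rho> j ^ n * w j \<le> 6 ^ n * (r i ^ n + \<rho> j ^ n) * w j"
        using w by (intro mult_right_mono) auto
      then show ?thesis using \<rho>(1)[of j] by (simp add: w_def power_divide)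
    qed
    have "E i \<inter> E j \<subseteq> (\<Union>p\<in>S i. \<Union>p'\<in>N p. ball p' (r j))"
      by (auto simp: E_def N_def)
    then have "measure lborel (E i \<inter> E j) \<le> measure lborel (\<Union>p\<in>S i. \<Union>p'\<in>N p. ball p' (r j))"
      using Em[OF i] Em[OF j] S(1)[OF i] finN by (intro measure_mono_fmeasurable) auto
    also have "\<dots> \<le> (\<Sum>p\<in>S i. measure lborel (\<Union>p'\<in>N p. ball p' (r j)))"
      using S(1)[OF i] finN by (intro measure_UNION_le) auto
    also have "\<dots> \<le> (\<Sum>p\<in>S i. \<Sum>p'\<in>N p. measure lborel (ball p' (r j)))"
      using finN by (intro sum_mono measure_UNION_le) auto
    also have "\<dots> = (\<Sum>p\<in>S i. v * (real (card (N p)) * r j ^ n))"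
      using r(1)[of j] by (simp add: measure_ball_lborel v_def n_def algebra_simps)
    also have "\<dots> \<le> (\<Sum>p\<in>S i. v * (6 ^ n * (r i ^ n + \<rho> j ^ n) * w j))"
      using cardN v by (intro sum_mono mult_left_mono) auto
    also have "\<dots> = v * 6 ^ n * w j * (real (card (S i)) * (r i ^ n + \<rho> j ^ n))"
      by (simp add: algebra_simps)
    also have "r i ^ n + \<rho> j ^ n \<le> \<rho> i ^ n * (w i + (1/2) ^ (j - i))"
    proof -
      have "\<rho> j ^ n \<le> (\<rho> i * (1/2) ^ (j - i)) ^ n"
        using \<rho>_ratio[OF ij] \<rho>(1)[of j] by (intro power_mono) auto
      also have "\<dots> = \<rho> i ^ n * ((1/2) ^ (j - i)) ^ n" by (simp add: power_mult_distrib)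
      also have "((1/2::real) ^ (j - i)) ^ n \<le> ((1/2) ^ (j - i)) ^ 1"
        using n by (intro power_decreasing) (auto simp: power_le_one)
      finally have "\<rho> j ^ n \<le> \<rho> i ^ n * (1/2) ^ (j - i)" using \<rho>(1)[of i] by simp
      moreover have "r i ^ n = \<rho> i ^ n * w i" using \<rho>(1)[of i] by (simp add: w_def power_divide)
      ultimately show ?thesis by (simp add: algebra_simps)
    qed
    also have "real (card (S i)) * (\<rho> i ^ n * (w i + (1/2) ^ (j - i))) \<le> R ^ n * (w i + (1/2) ^ (j - i))"
    proof -
      have "real (card (S i)) * \<rho> i ^ n \<le> R ^ n"
        unfolding n_def using S(1,3,4)[OF i] \<rho>(1)[of i] R by (intro card_disjoint_cballs_le) auto
      then have "real (card (S i)) * \<rho> i ^ n * (w i + (1/2) ^ (j - i)) \<le> R ^ n * (w i + (1/2) ^ (j - i))"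
        using w by (intro mult_right_mono) auto
      then show ?thesis by (simp add: algebra_simps)
    qed
    finally have "measure lborel (E i \<inter> E j) \<le> v * 6 ^ n * w j * (R ^ n * (w i + (1/2) ^ (j - i)))"
      using v w by (auto simp: mult_left_mono)
    also have "\<dots> = V * 6 ^ n * (w i * w j + (1/2) ^ (j - i) * w j)" using V by (simp add: algebra_simps)
    finally show ?thesis .
  qed
  define c where "c = ubiquity_const n"
  have tail: "c * V \<le> measure lborel (\<Union>j\<in>{J..<L}. E j)"
    if J: "J \<ge> J0" and L: "(\<Sum>j\<in>{J..<L}. w j) \<ge> 1" for J L
  proof -
    define I where "I = {J..<L}"
    define s where "s = (\<Sum>j\<in>I. w j)"
    have s: "s \<ge> 1" using L by (simp add: s_def I_def)
    have I: "finite I" "\<And>i. i \<in> I \<Longrightarrow> i \<ge> J0" using J by (auto simp: I_def)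
    define g where "g = (\<lambda>i j. if i \<le> j then (1/2::real) ^ (j - i) * w j else 0)"
    have g0: "g i j \<ge> 0" for i j using w by (simp add: g_def)
    have gsum: "(\<Sum>j\<in>I. \<Sum>i\<in>I. g i j) \<le> 2 * s"
    proof -
      have "(\<Sum>i\<in>I. g i j) \<le> 2 * w j" for j
      proof -
        have "(\<Sum>i\<in>I. g i j) = (\<Sum>i\<in>{i\<in>I. i \<le> j}. (1/2) ^ (j - i) * w j)"
          unfolding g_def using I(1) by (simp add: sum.inter_filter)
        also have "\<dots> = (\<Sum>i\<in>{i\<in>I. i \<le> j}. (1/2) ^ (j - i)) * w j"
          by (simp add: sum_distrib_right)
        also have "\<dots> \<le> 2 * w j" using sum_half_powers_le[OF I(1)] w by (intro mult_right_mono) auto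
        finally show ?thesis .
      qed
      then have "(\<Sum>j\<in>I. \<Sum>i\<in>I. g i j) \<le> (\<Sum>j\<in>I. 2 * w j)" by (intro sum_mono)
      then show ?thesis by (simp add: s_def sum_distrib_left)
    qed
    have pair: "measure lborel (E i \<inter> E j) \<le> V * 6 ^ n * (w i * w j + g i j + g j i)"
      if "i \<in> I" "j \<in> I" for i j
    proof (cases "i \<le> j")
      case True
      then have "measure lborel (E i \<inter> E j) \<le> V * 6 ^ n * (w i * w j + g i j)"
        using inter[of i j] I that by (simp add: g_def)
      also have "\<dots> \<le> V * 6 ^ n * (w i * w j + g i j + g j i)"
        using V g0[of j i] by (intro mult_left_mono) auto
      finally show ?thesis .
    next
      case False
      then have "measure lborel (E i \<inter> E j) \<le> V * 6 ^ n * (w i * w j + g j i)"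
        using inter[of j i] I that by (simp add: g_def Int_commute mult.commute)
      also have "\<dots> \<le> V * 6 ^ n * (w i * w j + g i j + g j i)"
        using V g0[of i j] by (intro mult_left_mono) auto
      finally show ?thesis .
    qed
    have "(\<Sum>i\<in>I. \<Sum>j\<in>I. measure lborel (E i \<inter> E j))
        \<le> (\<Sum>i\<in>I. \<Sum>j\<in>I. V * 6 ^ n * (w i * w j + g i j + g j i))"
      by (intro sum_mono pair)
    also have "\<dots> = V * 6 ^ n * ((\<Sum>i\<in>I. \<Sum>j\<in>I. w i * w j) + (\<Sum>i\<in>I. \<Sum>j\<in>I. g i j) + (\<Sum>i\<in>I. \<Sum>j\<in>I. g j i))"
      by (simp add: sum.distrib sum_distrib_left[symmetric])
    also have "(\<Sum>i\<in>I. \<Sum>j\<in>I. w i * w j) = s * s" by (simp add: s_def sum_product)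
    also have "(\<Sum>i\<in>I. \<Sum>j\<in>I. g i j) = (\<Sum>j\<in>I. \<Sum>i\<in>I. g i j)" by (rule sum.swap)
    also have "V * 6 ^ n * (s * s + (\<Sum>j\<in>I. \<Sum>i\<in>I. g i j) + (\<Sum>i\<in>I. \<Sum>j\<in>I. g j i))
        \<le> V * 6 ^ n * (s * s + 2 * s + 2 * s)"
      using V gsum by (intro mult_left_mono) auto
    also have "\<dots> \<le> V * 6 ^ n * (5 * s\<^sup>2)"
    proof (intro mult_left_mono)
      have "s * 1 \<le> s * s" using s by (intro mult_left_mono) auto
      then show "s * s + 2 * s + 2 * s \<le> 5 * s\<^sup>2" by (simp add: power2_eq_square)
    qed (use V in auto)
    finally have second: "(\<Sum>i\<in>I. \<Sum>j\<in>I. measure lborel (E i \<inter> E j)) \<le> V * 6 ^ n * (5 * s\<^sup>2)" .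
    have first: "V * s / (2 * 10 ^ n) \<le> (\<Sum>i\<in>I. measure lborel (E i))"
    proof -
      have "V * s / (2 * 10 ^ n) = (\<Sum>i\<in>I. V * w i / (2 * 10 ^ n))"
        by (simp add: s_def sum_distrib_left sum_divide_distrib)
      also have "\<dots> \<le> (\<Sum>i\<in>I. measure lborel (E i))" using lower I by (intro sum_mono) auto
      finally show ?thesis .
    qed
    \<comment> \<open>The optimal parameter of the second moment inequality is \<open>\<tau> / s\<close>.\<close>
    define \<tau> where "\<tau> = 1 / ((2 * 10 ^ n) * (5 * 6 ^ n) :: real)"
    have \<tau>: "\<tau> > 0" by (simp add: \<tau>_def)
    have "c * V = 2 * (\<tau> / s) * (V * s / (2 * 10 ^ n)) - (\<tau> / s)\<^sup>2 * (V * 6 ^ n * (5 * s\<^sup>2))"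
    proof -
      define a b :: real where "a = 2 * 10 ^ n" and "b = 5 * 6 ^ n"
      have ab: "a > 0" "b > 0" by (simp_all add: a_def b_def)
      have "2 * (\<tau> / s) * (V * s / (2 * 10 ^ n)) - (\<tau> / s)\<^sup>2 * (V * 6 ^ n * (5 * s\<^sup>2))
         = 2 * (\<tau> / s) * (V * s / a) - (\<tau> / s)\<^sup>2 * (V * b * s\<^sup>2)" by (simp add: a_def b_def)
      also have "\<dots> = 2 * \<tau> * V / a - \<tau>\<^sup>2 * V * b" using s by (simp add: power2_eq_square)
      also have "\<dots> = 2 * (1 / (a * b)) * V / a - (1 / (a * b))\<^sup>2 * V * b"
        by (simp add: \<tau>_def a_def b_def)
      finally have *: "2 * (\<tau> / s) * (V * s / (2 * 10 ^ n)) - (\<tau> / s)\<^sup>2 * (V * 6 ^ n * (5 * s\<^sup>2))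
         = 2 * (1 / (a * b)) * V / a - (1 / (a * b))\<^sup>2 * V * b" .
      have "2 * (1 / (a * b)) * V / a - (1 / (a * b))\<^sup>2 * V * b = V / (a\<^sup>2 * b)"
        using ab by (simp add: field_simps power2_eq_square)
      also have "\<dots> = c * V" by (simp add: c_def ubiquity_const_def a_def b_def)
      finally show ?thesis using * by linarith
    qed
    also have "\<dots> \<le> 2 * (\<tau> / s) * (\<Sum>i\<in>I. measure lborel (E i)) - (\<tau> / s)\<^sup>2 * (\<Sum>i\<in>I. \<Sum>j\<in>I. measure lborel (E i \<inter> E j))"
      using first second \<tau> s by (intro diff_mono mult_left_mono) auto
    also have "\<dots> \<le> measure lborel (\<Union>i\<in>I. E i)"
      using I Em by (intro measure_Union_ge_second_moment) auto
    finally show ?thesis by (simp add: I_def)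
  qed
  define G where "G = (\<lambda>J. ball x0 R \<inter> (\<Union>j\<in>{J..}. \<Union>p\<in>P j. ball p (r j)))"
  have Gm: "G J \<in> fmeasurable lborel" for J
  proof -
    have "open (\<Union>j\<in>{J..}. \<Union>p\<in>P j. ball p (r j))" by (intro open_UN ballI open_ball)
    then show ?thesis unfolding G_def by (intro fmeasurable_Int_fmeasurable) auto
  qed
  have Gge: "c * V \<le> measure lborel (G J)" for J
  proof -
    define J' where "J' = max J J0"
    obtain L where L: "(\<Sum>j\<in>{J'..<L}. w j) \<ge> 1"
    proof (rule ccontr)
      assume "\<not> thesis"
      then have lt: "(\<Sum>j\<in>{J'..<L}. w j) < 1" for L using that not_le by blast
      have "summable (\<lambda>j. w (j + J'))"
      proof (rule bounded_imp_summable)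
        fix k
        have "(\<Sum>j\<le>k. w (j + J')) = (\<Sum>j\<in>{J'..<Suc k + J'}. w j)"
          using sum.shift_bounds_nat_ivl[of w 0 J' "Suc k"] by (simp add: atLeast0LessThan lessThan_Suc_atMost)
        then show "(\<Sum>j\<le>k. w (j + J')) \<le> 1" using lt[of "Suc k + J'"] by simp
      qed (use w in auto)
      then have "summable w" using summable_iff_shift by blast
      then show False using div by (simp add: w_def n_def)
    qed
    have "c * V \<le> measure lborel (\<Union>j\<in>{J'..<L}. E j)" by (rule tail[OF _ L]) (simp add: J'_def)
    also have "\<dots> \<le> measure lborel (G J)"
    proof (rule measure_mono_fmeasurable[OF _ _ Gm])
      show "(\<Union>j\<in>{J'..<L}. E j) \<subseteq> G J"
      proof
        fix x assume "x \<in> (\<Union>j\<in>{J'..<L}. E j)"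
        then obtain j where j: "j \<ge> J'" "x \<in> E j" by auto
        then obtain p where jp: "p \<in> S j" "x \<in> ball p (r j)" unfolding E_def by blast
        note jp = j jp
        then have "j \<ge> J" "j \<ge> J0" by (auto simp: J'_def)
        then show "x \<in> G J" using jp Esub[of j] S(2)[of j] unfolding G_def by blast
      qed
      show "(\<Union>j\<in>{J'..<L}. E j) \<in> sets lborel"
      proof (intro sets.finite_UN)
        fix j assume "j \<in> {J'..<L}"
        then show "E j \<in> sets lborel" using Em[of j] by (intro fmeasurableD) (simp add: J'_def)
      qed simp
    qed
    finally show ?thesis .
  qed
  have lim: "(\<lambda>J. measure lborel (G J)) \<longlonglongrightarrow> measure lborel (\<Inter>J. G J)"
  proof (rule Lim_measure_decseq)
    show "decseq G" by (rule decseq_SucI) (use Suc_leD in \<open>unfold G_def atLeast_iff; blast\<close>)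
  qed (use Gm in \<open>auto simp: fmeasurable_def less_top[symmetric]\<close>)
  have "(\<Inter>J. G J) = ball x0 R \<inter> {x. \<exists>\<^sub>F j in sequentially. \<exists>p\<in>P j. x \<in> ball p (r j)}"
    unfolding G_def frequently_sequentially by blast
  moreover have "c * V \<le> measure lborel (\<Inter>J. G J)"
    using LIMSEQ_le_const[OF lim] Gge by blast
  ultimately show ?thesis by (simp add: c_def V_def n_def)
qed

section \<open>Null sets and translated fibres\<close>

text \<open>
  Integrating over \<open>X\<close> first, for fixed \<open>y\<close>, gives the measure of \<open>A\<close> by translation invariance. In this
  form a set can be measured along the translates of the range of \<open>g\<close> without splitting the space into
  that range and a complement.
\<close>

lemma nn_integral_emeasure_translates:
  fixes g :: "'a::euclidean_space \<Rightarrow> 'b::euclidean_space"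
  assumes [measurable]: "A \<in> sets borel" "Y \<in> sets borel" "g \<in> borel_measurable borel"
  shows "(\<integral>\<^sup>+X. emeasure lborel {y\<in>Y. X + g y \<in> A} \<partial>lborel) = emeasure lborel Y * emeasure lborel A"
proof -
  have "(\<integral>\<^sup>+X. emeasure lborel {y\<in>Y. X + g y \<in> A} \<partial>lborel)
      = (\<integral>\<^sup>+X. \<integral>\<^sup>+y. indicator Y y * indicator A (X + g y) \<partial>lborel \<partial>lborel)"
  proof (intro nn_integral_cong)
    fix X :: 'b
    have [measurable]: "{y\<in>Y. X + g y \<in> A} \<in> sets borel" by measurable
    have "emeasure lborel {y\<in>Y. X + g y \<in> A} = (\<integral>\<^sup>+y. indicator {y\<in>Y. X + g y \<in> A} y \<partial>lborel)"
      by simp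
    also have "\<dots> = (\<integral>\<^sup>+y. indicator Y y * indicator A (X + g y) \<partial>lborel)"
      by (intro nn_integral_cong) (auto split: split_indicator)
    finally show "emeasure lborel {y\<in>Y. X + g y \<in> A} = (\<integral>\<^sup>+y. indicator Y y * indicator A (X + g y) \<partial>lborel)" .
  qed
  also have "\<dots> = (\<integral>\<^sup>+y. \<integral>\<^sup>+X. indicator Y y * indicator A (X + g y) \<partial>lborel \<partial>lborel)"
    by (rule lborel_pair.Fubini') measurable
  also have "\<dots> = (\<integral>\<^sup>+y. indicator Y y * emeasure lborel A \<partial>lborel)"
  proof (intro nn_integral_cong)
    fix y :: 'a
    have "(\<integral>\<^sup>+X. indicator Y y * indicator A (X + g y) \<partial>lborel)
      = indicator Y y * (\<integral>\<^sup>+X. indicator A (g y + X) \<partial>lborel)"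
      by (subst nn_integral_cmult) (auto simp: add.commute)
    also have "(\<integral>\<^sup>+X. indicator A (g y + X) \<partial>lborel) = (\<integral>\<^sup>+X. indicator A X \<partial>distr lborel borel ((+) (g y)))"
      by (subst nn_integral_distr) auto
    also have "\<dots> = emeasure lborel A" by (simp add: lborel_distr_plus)
    finally show "(\<integral>\<^sup>+X. indicator Y y * indicator A (X + g y) \<partial>lborel) = indicator Y y * emeasure lborel A" .
  qed
  also have "\<dots> = emeasure lborel Y * emeasure lborel A"
    by (simp add: nn_integral_multc)
  finally show ?thesis .
qed

text \<open>
  For \<open>Y = UNIV\<close> the previous identity reads \<open>0 = \<infinity> * |A|\<close>, where \<open>A\<close> is the exceptional set.
\<close>

lemma AE_of_AE_translates:
  fixes g :: "'a::euclidean_space \<Rightarrow> 'b::euclidean_space"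
  assumes A: "{X. P X} \<in> sets borel" and g: "g \<in> borel_measurable borel"
    and ae: "AE X in lborel. AE y in lborel. P (X + g y)"
  shows "AE X in lborel. P X"
proof -
  have A': "{X. \<not> P X} \<in> sets borel"
    using borel_comp[OF A] by (simp add: Collect_neg_eq)
  have "emeasure lborel (UNIV :: 'a set) * emeasure lborel {X. \<not> P X}
      = (\<integral>\<^sup>+X. emeasure lborel {y\<in>UNIV. X + g y \<in> {X. \<not> P X}} \<partial>lborel)"
    using A' g by (intro nn_integral_emeasure_translates[symmetric]) auto
  also have "\<dots> = (\<integral>\<^sup>+(X::'b). 0 \<partial>lborel)"
  proof (rule nn_integral_cong_AE)
    show "AE X in lborel. emeasure lborel {y\<in>UNIV. X + g y \<in> {X. \<not> P X}} = 0"
      using ae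
    proof eventually_elim
      fix X :: 'b assume X: "AE y in lborel. P (X + g y)"
      have "{y. \<not> P (X + g y)} = (\<lambda>y. X + g y) -` {X. \<not> P X} \<inter> space borel" by auto
      also have "\<dots> \<in> sets borel" using g A' by (intro measurable_sets[of _ borel borel]) auto
      finally have "{y. \<not> P (X + g y)} \<in> sets borel" .
      then show "emeasure lborel {y\<in>UNIV. X + g y \<in> {X. \<not> P X}} = 0"
        using X by (subst (asm) AE_iff_measurable[where N = "{y. \<not> P (X + g y)}"]) auto
    qed
  qed
  finally have "emeasure lborel {X. \<not> P X} = 0"
    by (simp add: emeasure_lborel_UNIV)
  then show ?thesis
    using A' by (subst AE_iff_measurable[where N = "{X. \<not> P X}"]) auto
qed

section \<open>Integer vectors and their heights\<close>

lemma real_vec_mult_add_axis: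
  fixes X :: "real ^ 'n ^ 'm"
  shows "real_vec q v* (X + axis a y) = real_vec q v* X + of_int (q $ a) *\<^sub>R y"
proof -
  have "(\<Sum>i\<in>UNIV. of_int (q $ i) * (X $ i $ j + axis a y $ i $ j))
      = (\<Sum>i\<in>UNIV. of_int (q $ i) * X $ i $ j) + of_int (q $ a) * y $ j" for j
  proof -
    have "(\<Sum>i\<in>UNIV. of_int (q $ i) * axis a y $ i $ j) = (\<Sum>i\<in>UNIV. if i = a then of_int (q $ a) * y $ j else 0)"
      by (intro sum.cong refl) (auto simp: axis_def)
    then show ?thesis by (simp add: distrib_left sum.distrib)
  qed
  then show ?thesis
    by (simp add: vec_eq_iff vector_matrix_mult_def real_vec_def mult.commute)
qed

lemma infnorm_le_iff:
  fixes v :: "real ^ 'n"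
  shows "infnorm v \<le> c \<longleftrightarrow> (\<forall>j. \<bar>v $ j\<bar> \<le> c)"
proof
  assume "infnorm v \<le> c"
  then show "\<forall>j. \<bar>v $ j\<bar> \<le> c" using component_le_infnorm_cart[of v] order_trans by blast
next
  assume "\<forall>j. \<bar>v $ j\<bar> \<le> c"
  then show "infnorm v \<le> c" unfolding infnorm_cart by (intro cSup_least) auto
qed

definition height :: "int ^ 'm \<Rightarrow> nat" where
  "height q = nat (Max (range (\<lambda>i. \<bar>q $ i\<bar>)))"

lemma height_le_iff: "height q \<le> N \<longleftrightarrow> (\<forall>i. \<bar>q $ i\<bar> \<le> int N)"
  unfolding height_def by (simp add: nat_le_iff)

lemma abs_le_height: "\<bar>q $ i\<bar> \<le> int (height q)"
  using height_le_iff[of q "height q"] by simp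

lemma height_attained: "\<exists>i. \<bar>q $ i\<bar> = int (height q)"
proof -
  have "Max (range (\<lambda>i. \<bar>q $ i\<bar>)) \<in> range (\<lambda>i. \<bar>q $ i\<bar>)" by (intro Max_in) auto
  then obtain i where i: "Max (range (\<lambda>i. \<bar>q $ i\<bar>)) = \<bar>q $ i\<bar>" by (rule rangeE)
  then show ?thesis unfolding height_def by (intro exI[of _ i]) simp
qed

lemma height_pos_iff: "0 < height q \<longleftrightarrow> q \<noteq> 0"
  using height_le_iff[of q 0] by (auto simp: vec_eq_iff)

lemma infnorm_real_vec: "infnorm (real_vec q) = real (height q)"
proof (rule antisym)
  show "infnorm (real_vec q) \<le> real (height q)"
    unfolding infnorm_le_iff real_vec_def
  proof
    fix i
    have "real_of_int \<bar>q $ i\<bar> \<le> real_of_int (int (height q))"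
      using abs_le_height[of q i] by (simp only: of_int_le_iff)
    then show "\<bar>(\<chi> i. real_of_int (q $ i)) $ i\<bar> \<le> real (height q)" by simp
  qed
  obtain i where "\<bar>q $ i\<bar> = int (height q)" using height_attained by blast
  then have "real (height q) = \<bar>real_vec q $ i\<bar>" unfolding real_vec_def
    by (metis of_int_abs of_int_of_nat_eq vec_lambda_beta)
  then show "real (height q) \<le> infnorm (real_vec q)" using component_le_infnorm_cart[of "real_vec q" i] by simp
qed

lemma card_int_vec_box:
  fixes F :: "'m::finite \<Rightarrow> int set"
  assumes "\<And>i. finite (F i)"
  shows "finite {q :: int ^ 'm. \<forall>i. q $ i \<in> F i}" "card {q :: int ^ 'm. \<forall>i. q $ i \<in> F i} = (\<Prod>i\<in>UNIV. card (F i))"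
proof -
  have eq: "{q :: int ^ 'm. \<forall>i. q $ i \<in> F i} = vec_lambda ` (Pi\<^sub>E UNIV F)"
  proof (intro set_eqI iffI)
    fix q :: "int ^ 'm" assume "q \<in> {q. \<forall>i. q $ i \<in> F i}"
    then have "vec_nth q \<in> Pi\<^sub>E UNIV F" by (simp add: PiE_UNIV_domain)
    then show "q \<in> vec_lambda ` (Pi\<^sub>E UNIV F)" by (intro image_eqI[of _ _ "vec_nth q"]) simp_all
  next
    fix q :: "int ^ 'm" assume "q \<in> vec_lambda ` (Pi\<^sub>E UNIV F)"
    then show "q \<in> {q. \<forall>i. q $ i \<in> F i}" by (auto simp: PiE_UNIV_domain)
  qed
  have inj: "inj_on vec_lambda (Pi\<^sub>E UNIV F)" by (rule inj_onI) (simp add: vec_lambda_inject)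
  show "finite {q :: int ^ 'm. \<forall>i. q $ i \<in> F i}" unfolding eq using assms by (intro finite_imageI finite_PiE) auto
  show "card {q :: int ^ 'm. \<forall>i. q $ i \<in> F i} = (\<Prod>i\<in>UNIV. card (F i))"
    unfolding eq using card_image[OF inj] by (simp add: card_PiE)
qed

lemma finite_height_le: "finite {q :: int ^ 'm::finite. height q \<le> N}"
  using card_int_vec_box(1)[of "\<lambda>_. {- int N..int N}"]
  by (simp add: height_le_iff abs_le_iff minus_le_iff conj_commute)

text \<open>
  Some coordinate outside \<open>Z\<close> equals \<open>r\<close> or \<open>-r\<close>, and at most \<open>2 * r + 1 \<le> 3 * r\<close> values remain for each
  of the others. The set \<open>Z\<close> of vanishing coordinates is empty for the convergence half of the theorem
  and a singleton when forms without a given coordinate are excluded.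
\<close>

lemma card_shell_le:
  fixes Z :: "'m::finite set"
  assumes r: "r > 0"
  shows "real (card {q :: int ^ 'm. (\<forall>i\<in>Z. q $ i = 0) \<and> height q = r})
     \<le> 2 * real CARD('m) * 3 ^ CARD('m) * real r ^ (CARD('m) - card Z - 1)"
proof -
  define F where "F = (\<lambda>k i. if i \<in> Z then {0} else if i = k then {int r, - int r} else {- int r..int r})"
  have fin: "finite (F k i)" for k i by (simp add: F_def)
  define G where "G = (\<lambda>k. {q :: int ^ 'm. \<forall>i. q $ i \<in> F k i})"
  have sub: "{q :: int ^ 'm. (\<forall>i\<in>Z. q $ i = 0) \<and> height q = r} \<subseteq> (\<Union>k\<in>-Z. G k)"
  proof
    fix q :: "int ^ 'm" assume q: "q \<in> {q. (\<forall>i\<in>Z. q $ i = 0) \<and> height q = r}"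
    obtain k where k: "\<bar>q $ k\<bar> = int (height q)" using height_attained by blast
    then have "k \<notin> Z" using q r by auto
    moreover have "q \<in> G k"
      using q k abs_le_height[of q] unfolding G_def F_def by (auto simp: abs_le_iff minus_le_iff abs_eq_iff')
    ultimately show "q \<in> (\<Union>k\<in>-Z. G k)" by blast
  qed
  have cardG: "card (G k) \<le> 2 * (3 * r) ^ (CARD('m) - card Z - 1)" if k: "k \<notin> Z" for k
  proof -
    have "card (G k) = (\<Prod>i\<in>UNIV. card (F k i))" unfolding G_def using fin by (rule card_int_vec_box(2))
    also have "\<dots> = card (F k k) * (\<Prod>i\<in>UNIV - {k}. card (F k i))" by (subst prod.remove[of _ k]) auto
    also have "(\<Prod>i\<in>UNIV - {k}. card (F k i)) = (\<Prod>i\<in>UNIV - {k} - Z. card (F k i))"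
      by (rule prod.mono_neutral_right) (auto simp: F_def)
    also have "\<dots> \<le> (\<Prod>i\<in>UNIV - {k} - Z. 3 * r)" using r by (intro prod_mono) (auto simp: F_def)
    also have "\<dots> = (3 * r) ^ (CARD('m) - card Z - 1)"
    proof -
      have "UNIV - {k} - Z = UNIV - insert k Z" by auto
      then have "card (UNIV - {k} - Z) = CARD('m) - card Z - 1"
        using k by (simp add: card_Diff_subset)
      then show ?thesis by simp
    qed
    also have "card (F k k) \<le> 2" using k by (simp add: F_def card_insert_if)
    finally show ?thesis by simp
  qed
  have "card {q :: int ^ 'm. (\<forall>i\<in>Z. q $ i = 0) \<and> height q = r} \<le> card (\<Union>k\<in>-Z. G k)"
    using sub fin by (intro card_mono finite_UN_I) (auto simp: G_def intro: card_int_vec_box(1))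
  also have "\<dots> \<le> (\<Sum>k\<in>-Z. card (G k))" by (intro card_UN_le) auto
  also have "\<dots> \<le> (\<Sum>k\<in>-Z. 2 * (3 * r) ^ (CARD('m) - card Z - 1))" using cardG by (intro sum_mono) auto
  also have "\<dots> \<le> CARD('m) * (2 * (3 * r) ^ (CARD('m) - card Z - 1))"
    by (simp add: card_mono)
  finally have "real (card {q :: int ^ 'm. (\<forall>i\<in>Z. q $ i = 0) \<and> height q = r})
      \<le> real (CARD('m) * (2 * (3 * r) ^ (CARD('m) - card Z - 1)))" by (rule of_nat_mono)
  also have "\<dots> = 2 * real CARD('m) * 3 ^ (CARD('m) - card Z - 1) * real r ^ (CARD('m) - card Z - 1)"
    by (simp add: power_mult_distrib)
  also have "\<dots> \<le> 2 * real CARD('m) * 3 ^ CARD('m) * real r ^ (CARD('m) - card Z - 1)"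
    by (intro mult_left_mono mult_right_mono power_increasing) auto
  finally show ?thesis .
qed

section \<open>Almost all matrices have few small values of integral forms\<close>

lemma strip_eq_cbox:
  fixes u :: "real ^ 'n"
  assumes s: "s \<noteq> 0"
  shows "{y. infnorm (u + s *\<^sub>R y) \<le> h}
    = cbox (\<chi> j. - u $ j / s - h / \<bar>s\<bar>) (\<chi> j. - u $ j / s + h / \<bar>s\<bar>)"
proof -
  have "\<bar>u $ j + s * y $ j\<bar> \<le> h \<longleftrightarrow>
      - u $ j / s - h / \<bar>s\<bar> \<le> y $ j \<and> y $ j \<le> - u $ j / s + h / \<bar>s\<bar>" for y :: "real ^ 'n" and j
  proof -
    have "u $ j + s * y $ j = s * (y $ j + u $ j / s)" using s by (simp add: field_simps)
    then have "\<bar>u $ j + s * y $ j\<bar> \<le> h \<longleftrightarrow> \<bar>y $ j + u $ j / s\<bar> \<le> h / \<bar>s\<bar>"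
      using s by (simp add: abs_mult pos_le_divide_eq mult.commute)
    then show ?thesis by (auto simp: abs_le_iff)
  qed
  then show ?thesis by (auto simp: infnorm_le_iff mem_box_cart)
qed

lemma emeasure_strip:
  fixes u :: "real ^ 'n"
  assumes s: "s \<noteq> 0" and h: "0 \<le> h"
  shows "emeasure lborel {y. infnorm (u + s *\<^sub>R y) \<le> h} = ennreal ((2 * h / \<bar>s\<bar>) ^ CARD('n))"
proof -
  let ?a = "\<chi> j. - u $ j / s - h / \<bar>s\<bar>" and ?b = "\<chi> j. - u $ j / s + h / \<bar>s\<bar>"
  have ne: "cbox ?a ?b \<noteq> {}" using h by (simp add: interval_ne_empty_cart)
  have "measure lborel (cbox ?a ?b) = (\<Prod>j\<in>(UNIV::'n set). 2 * h / \<bar>s\<bar>)"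
    unfolding content_cbox_cart[OF ne] by (intro prod.cong) auto
  also have "\<dots> = (2 * h / \<bar>s\<bar>) ^ CARD('n)" by simp
  finally show ?thesis
    unfolding strip_eq_cbox[OF s]
    by (subst emeasure_eq_ennreal_measure) (use emeasure_lborel_cbox_finite in \<open>auto simp: less_top[symmetric]\<close>)
qed

lemma continuous_on_real_vec_mult:
  "continuous_on A (\<lambda>X :: real ^ 'n ^ 'm. infnorm (real_vec q v* X))"
  unfolding vector_matrix_mult_def by (intro continuous_intros)

lemma borel_real_vec_mult_le [measurable]:
  "{X :: real ^ 'n ^ 'm. infnorm (real_vec q v* X) \<le> h} \<in> sets borel"
  by (intro borel_closed closed_Collect_le continuous_on_real_vec_mult) auto

definition matrix_box :: "real \<Rightarrow> (real ^ 'n ^ 'm) set" where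
  "matrix_box A = {X. \<forall>i j. \<bar>X $ i $ j\<bar> \<le> A}"

lemma matrix_box_borel [measurable]: "matrix_box A \<in> sets borel"
  unfolding matrix_box_def
  by (intro borel_closed closed_Collect_all closed_Collect_le continuous_intros)

lemma emeasure_matrix_box_finite: "emeasure lborel (matrix_box A) < \<infinity>"
proof (rule emeasure_bounded_finite)
  show "bounded (matrix_box A :: (real ^ 'n ^ 'm) set)"
    unfolding matrix_box_def
  proof (rule boundedI)
    fix X :: "real ^ 'n ^ 'm" assume "X \<in> {X. \<forall>i j. \<bar>X $ i $ j\<bar> \<le> A}"
    then have X: "\<bar>X $ i $ j\<bar> \<le> A" for i j by simp
    have "norm X \<le> (\<Sum>i\<in>UNIV. norm (X $ i))"
      unfolding norm_vec_def[of X] by (rule L2_set_le_sum) auto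
    also have "\<dots> \<le> (\<Sum>i\<in>(UNIV::'m set). \<Sum>j\<in>(UNIV::'n set). A)"
      using X by (intro sum_mono order.trans[OF norm_le_l1_cart]) auto
    finally show "norm X \<le> (\<Sum>i\<in>(UNIV::'m set). \<Sum>j\<in>(UNIV::'n set). A)" .
  qed
qed

lemma continuous_on_axis: "continuous_on UNIV (axis a :: real ^ 'n \<Rightarrow> real ^ 'n ^ 'm)"
  unfolding axis_def
proof (rule continuous_on_vec_lambda)
  fix i :: 'm
  show "continuous_on UNIV (\<lambda>x :: real ^ 'n. if i = a then x else 0)"
    by (cases "i = a") simp_all
qed

lemma borel_measurable_axis [measurable]:
  "(axis a :: real ^ 'n \<Rightarrow> real ^ 'n ^ 'm) \<in> borel_measurable borel"
  by (rule borel_measurable_continuous_onI[OF continuous_on_axis])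

text \<open>
  Averaging over translations of a row \<open>a\<close> with \<open>|q\<^sub>a|\<close> equal to the height of \<open>q\<close> replaces the set by its
  fibres, which lie in cubes of side \<open>2 h / |q\<^sub>a|\<close>. Translating by rows of norm at most \<open>1\<close> leads from the box
  of size \<open>A\<close> to the box of size \<open>A + 1\<close>, and only the volume of the latter enters the constant.
\<close>

lemma exists_strip_measure_bound:
  "\<exists>C\<ge>0. \<forall>q h. q \<noteq> 0 \<longrightarrow> 0 \<le> h \<longrightarrow>
     emeasure lborel {X \<in> matrix_box A. infnorm (real_vec q v* (X :: real ^ 'n ^ 'm)) \<le> h}
       \<le> ennreal (C * (h / real (height q)) ^ CARD('n))"
proof -
  define Y :: "(real ^ 'n) set" where "Y = cbox (\<chi> j. - 1) (\<chi> j. 1)"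
  define V where "V = measure lborel (matrix_box (A + 1) :: (real ^ 'n ^ 'm) set)"
  have Vem: "emeasure lborel (matrix_box (A + 1) :: (real ^ 'n ^ 'm) set) = ennreal V"
    unfolding V_def using emeasure_matrix_box_finite
    by (intro emeasure_eq_ennreal_measure) (auto simp: less_top[symmetric])
  have Yem: "emeasure lborel (Y :: (real ^ 'n) set) = ennreal (2 ^ CARD('n))"
  proof -
    have "(Y :: (real ^ 'n) set) = {y. infnorm (0 + 1 *\<^sub>R y) \<le> 1}"
      by (subst strip_eq_cbox) (auto simp: Y_def)
    then show ?thesis by (simp only:) (subst emeasure_strip, auto)
  qed
  have Ymem: "y \<in> Y \<longleftrightarrow> (\<forall>j. \<bar>y $ j\<bar> \<le> 1)" for y :: "real ^ 'n"
    by (auto simp: Y_def mem_box_cart abs_le_iff minus_le_iff[of _ 1])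
  have main: "emeasure lborel {X \<in> matrix_box A. infnorm (real_vec q v* (X :: real ^ 'n ^ 'm)) \<le> h}
       \<le> ennreal (V * (h / real (height q)) ^ CARD('n))" if q: "q \<noteq> 0" and h: "0 \<le> h" for q h
  proof -
    obtain a where a: "\<bar>q $ a\<bar> = int (height q)" using height_attained by blast
    have ra: "\<bar>real_of_int (q $ a)\<bar> = real (height q)"
      using a by (metis of_int_abs of_int_of_nat_eq)
    have pos: "height q > 0" using q height_pos_iff by blast
    define S where "S = {X \<in> matrix_box A. infnorm (real_vec q v* (X :: real ^ 'n ^ 'm)) \<le> h}"
    have S: "S \<in> sets borel"
    proof -
      have "S = matrix_box A \<inter> {X. infnorm (real_vec q v* X) \<le> h}" by (auto simp: S_def)
      then show ?thesis by simp
    qed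
    define B where "B = (2 * h / real (height q)) ^ CARD('n)"
    have B: "B \<ge> 0" using h by (simp add: B_def)
    have "ennreal (2 ^ CARD('n)) * emeasure lborel S = (\<integral>\<^sup>+(X :: real ^ 'n ^ 'm). emeasure lborel {y\<in>Y. X + axis a y \<in> S} \<partial>lborel)"
      unfolding Yem[symmetric] using S borel_measurable_axis by (intro nn_integral_emeasure_translates[symmetric]) (auto simp: Y_def)
    also have "\<dots> \<le> (\<integral>\<^sup>+X. ennreal B * indicator (matrix_box (A + 1)) (X :: real ^ 'n ^ 'm) \<partial>lborel)"
    proof (rule nn_integral_mono)
      fix X :: "real ^ 'n ^ 'm"
      show "emeasure lborel {y\<in>Y. X + axis a y \<in> S} \<le> ennreal B * indicator (matrix_box (A + 1)) X"
      proof (cases "X \<in> matrix_box (A + 1)")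
        case True
        have "emeasure lborel {y\<in>Y. X + axis a y \<in> S}
            \<le> emeasure lborel {y. infnorm (real_vec q v* X + real_of_int (q $ a) *\<^sub>R y) \<le> h}"
        proof (rule emeasure_mono)
          have nz: "real_of_int (q $ a) \<noteq> 0" using pos ra by auto
          show "{y. infnorm (real_vec q v* X + real_of_int (q $ a) *\<^sub>R y) \<le> h} \<in> sets lborel"
            unfolding strip_eq_cbox[OF nz] by simp
        qed (auto simp: S_def real_vec_mult_add_axis)
        also have "\<dots> = ennreal ((2 * h / real (height q)) ^ CARD('n))"
          using pos ra h by (subst emeasure_strip) auto
        finally show ?thesis using True by (simp add: B_def)
      next
        case False
        then obtain i j where ij: "\<bar>X $ i $ j\<bar> > A + 1" by (auto simp: matrix_box_def not_le)
        have e: "{y\<in>Y. X + axis a y \<in> S} = {}"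
        proof (rule ccontr)
          assume "{y\<in>Y. X + axis a y \<in> S} \<noteq> {}"
          then obtain y where y: "y \<in> Y" "X + axis a y \<in> matrix_box A" by (auto simp: S_def)
          then have "\<bar>(X + axis a y) $ i $ j\<bar> \<le> A" by (simp add: matrix_box_def)
          moreover have "\<bar>axis a y $ i $ j\<bar> \<le> 1" using y(1) by (auto simp: axis_def Ymem)
          ultimately show False using ij by simp
        qed
        show ?thesis unfolding e by simp
      qed
    qed
    also have "\<dots> = ennreal B * ennreal V"
      by (subst nn_integral_cmult_indicator) (auto simp: Vem)
    also have "\<dots> = ennreal (2 ^ CARD('n)) * ennreal (V * (h / real (height q)) ^ CARD('n))"
    proof -
      have "B * V = 2 ^ CARD('n) * (V * (h / real (height q)) ^ CARD('n))"
        by (simp add: B_def power_mult_distrib power_divide)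
      then show ?thesis using h B by (simp add: ennreal_mult[symmetric] V_def)
    qed
    finally show ?thesis
      unfolding S_def[symmetric] by (subst (asm) ennreal_mult_le_mult_iff) auto
  qed
  show ?thesis by (rule exI[of _ V]) (use main in \<open>auto simp: V_def\<close>)
qed

text \<open>
  The Borel-Cantelli lemma is applied inside a box, with one event for each height \<open>r\<close>. Only finitely many
  forms have a given height, so finitely many events leave finitely many forms.
\<close>

lemma AE_finitely_many_small_forms:
  fixes Q :: "(int ^ 'm::finite) set" and h :: "nat \<Rightarrow> real"
  assumes h: "\<And>r. 0 \<le> h r"
    and sum: "summable (\<lambda>r. real (card {q\<in>Q. height q = r}) * (h r / real r) ^ CARD('n::finite))"
  shows "AE X :: real ^ 'n ^ 'm in lborel. finite {q\<in>Q. q \<noteq> 0 \<and> infnorm (real_vec q v* X) \<le> h (height q)}"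
proof -
  have bounded: "AE X :: real ^ 'n ^ 'm in lborel. X \<in> matrix_box (real k) \<longrightarrow>
      finite {q\<in>Q. q \<noteq> 0 \<and> infnorm (real_vec q v* X) \<le> h (height q)}" for k :: nat
  proof -
    obtain C where C: "C \<ge> 0" "\<And>q h. q \<noteq> 0 \<Longrightarrow> 0 \<le> h \<Longrightarrow>
       emeasure lborel {X \<in> matrix_box (real k). infnorm (real_vec q v* (X :: real ^ 'n ^ 'm)) \<le> h}
       \<le> ennreal (C * (h / real (height q)) ^ CARD('n))"
      using exists_strip_measure_bound[of "real k"] by blast
    define H where "H = (\<lambda>r. {q\<in>Q. q \<noteq> 0 \<and> height q = r})"
    define A where "A = (\<lambda>r. \<Union>q\<in>H r. {X \<in> matrix_box (real k). infnorm (real_vec q v* (X :: real ^ 'n ^ 'm)) \<le> h r})"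
    have finH: "finite (H r)" for r
      by (rule finite_subset[OF _ finite_height_le[of r]]) (auto simp: H_def)
    have strip: "{X \<in> matrix_box (real k). infnorm (real_vec q v* (X :: real ^ 'n ^ 'm)) \<le> h r} \<in> sets lborel" for q r
    proof -
      have "{X \<in> matrix_box (real k). infnorm (real_vec q v* (X :: real ^ 'n ^ 'm)) \<le> h r}
         = matrix_box (real k) \<inter> {X. infnorm (real_vec q v* X) \<le> h r}" by auto
      then show ?thesis by simp
    qed
    have A: "A r \<in> sets lborel" for r unfolding A_def using finH strip by (intro sets.finite_UN) auto
    have em: "emeasure lborel (A r) \<le> ennreal (C * (real (card {q\<in>Q. height q = r}) * (h r / real r) ^ CARD('n)))" for r
    proof -
      have "emeasure lborel (A r) \<le> (\<Sum>q\<in>H r. emeasure lborel {X \<in> matrix_box (real k). infnorm (real_vec q v* (X :: real ^ 'n ^ 'm)) \<le> h r})"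
        unfolding A_def using finH strip by (intro emeasure_subadditive_finite) auto
      also have "\<dots> \<le> (\<Sum>q\<in>H r. ennreal (C * (h r / real r) ^ CARD('n)))"
        using C(2) h by (intro sum_mono) (auto simp: H_def)
      also have "\<dots> = ennreal (real (card (H r)) * (C * (h r / real r) ^ CARD('n)))"
        using C(1) h by (simp add: ennreal_mult ennreal_of_nat_eq_real_of_nat)
      also have "\<dots> \<le> ennreal (C * (real (card {q\<in>Q. height q = r}) * (h r / real r) ^ CARD('n)))"
      proof (rule ennreal_leI)
        have "card (H r) \<le> card {q\<in>Q. height q = r}"
          by (rule card_mono) (auto simp: H_def intro: finite_subset[OF _ finite_height_le[of r]])
        then have "real (card (H r)) * (C * (h r / real r) ^ CARD('n))
            \<le> real (card {q\<in>Q. height q = r}) * (C * (h r / real r) ^ CARD('n))"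
          using C(1) h by (intro mult_right_mono) auto
        then show "real (card (H r)) * (C * (h r / real r) ^ CARD('n))
          \<le> C * (real (card {q\<in>Q. height q = r}) * (h r / real r) ^ CARD('n))" by (simp add: algebra_simps)
      qed
      finally show ?thesis .
    qed
    have fin: "emeasure lborel (A r) < \<infinity>" for r
      using em[of r] by (rule le_less_trans) simp
    have "AE X in lborel. eventually (\<lambda>r. X \<in> space lborel - A r) sequentially"
    proof (rule borel_cantelli_AE1[OF A fin])
      show "summable (\<lambda>r. measure lborel (A r))"
      proof (rule summable_comparison_test[OF _ summable_mult[OF sum, of C]], intro exI allI impI)
        fix r :: nat
        have "measure lborel (A r) \<le> C * (real (card {q\<in>Q. height q = r}) * (h r / real r) ^ CARD('n))"
          unfolding measure_def using em[of r] C(1) h by (intro enn2real_leI) auto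
        then show "norm (measure lborel (A r)) \<le> C * (real (card {q\<in>Q. height q = r}) * (h r / real r) ^ CARD('n))"
          by simp
      qed
    qed
    then show ?thesis
    proof eventually_elim
      fix X :: "real ^ 'n ^ 'm" assume "eventually (\<lambda>r. X \<in> space lborel - A r) sequentially"
      then obtain r0 where r0: "\<And>r. r \<ge> r0 \<Longrightarrow> X \<notin> A r" by (auto simp: eventually_sequentially)
      show "X \<in> matrix_box (real k) \<longrightarrow> finite {q\<in>Q. q \<noteq> 0 \<and> infnorm (real_vec q v* X) \<le> h (height q)}"
      proof
        assume X: "X \<in> matrix_box (real k)"
        have "height q < r0" if "q \<in> Q" "q \<noteq> 0" "infnorm (real_vec q v* X) \<le> h (height q)" for q
        proof (rule ccontr)
          assume "\<not> height q < r0"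
          then have "X \<notin> A (height q)" using r0 by simp
          then show False using that X by (auto simp: A_def H_def)
        qed
        then show "finite {q\<in>Q. q \<noteq> 0 \<and> infnorm (real_vec q v* X) \<le> h (height q)}"
          by (intro finite_subset[OF _ finite_height_le[of r0]]) (auto intro: less_imp_le)
      qed
    qed
  qed
  then have "AE X :: real ^ 'n ^ 'm in lborel. \<forall>k. X \<in> matrix_box (real k) \<longrightarrow>
      finite {q\<in>Q. q \<noteq> 0 \<and> infnorm (real_vec q v* X) \<le> h (height q)}"
    by (intro AE_all_countable[THEN iffD2] allI)
  then show ?thesis
  proof eventually_elim
    fix X :: "real ^ 'n ^ 'm" assume *: "\<forall>k. X \<in> matrix_box (real k) \<longrightarrow>
      finite {q\<in>Q. q \<noteq> 0 \<and> infnorm (real_vec q v* X) \<le> h (height q)}"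
    obtain k :: nat where k: "norm X \<le> real k" using real_arch_simple by blast
    have "\<bar>X $ i $ j\<bar> \<le> real k" for i j
      using component_le_norm_cart[of "X $ i" j] Finite_Cartesian_Product.norm_nth_le[of X i] k by simp
    then show "finite {q\<in>Q. q \<noteq> 0 \<and> infnorm (real_vec q v* X) \<le> h (height q)}"
      using * by (auto simp: matrix_box_def)
  qed
qed

lemma AE_finitely_many_small_forms_vanishing:
  fixes Z :: "'m::finite set" and h :: "nat \<Rightarrow> real"
  assumes h: "\<And>r. 0 \<le> h r"
    and sum: "summable (\<lambda>r. real r ^ (CARD('m) - card Z - 1) * (h r / real r) ^ CARD('n::finite))"
  shows "AE X :: real ^ 'n ^ 'm in lborel.
    finite {q. (\<forall>i\<in>Z. q $ i = 0) \<and> q \<noteq> 0 \<and> infnorm (real_vec q v* X) \<le> h (height q)}"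
proof -
  let ?Q = "{q :: int ^ 'm. \<forall>i\<in>Z. q $ i = 0}"
  let ?c = "2 * real CARD('m) * 3 ^ CARD('m)"
  have "summable (\<lambda>r. real (card {q\<in>?Q. height q = r}) * (h r / real r) ^ CARD('n))"
  proof (rule summable_comparison_test[OF _ summable_mult[OF sum, of ?c]], intro exI allI impI)
    fix r :: nat assume "1 \<le> r"
    then have "real (card {q\<in>?Q. height q = r}) \<le> ?c * real r ^ (CARD('m) - card Z - 1)"
      using card_shell_le[of r Z] by simp
    then have "real (card {q\<in>?Q. height q = r}) * (h r / real r) ^ CARD('n)
        \<le> ?c * real r ^ (CARD('m) - card Z - 1) * (h r / real r) ^ CARD('n)"
      using h[of r] by (intro mult_right_mono) auto
    then show "norm (real (card {q\<in>?Q. height q = r}) * (h r / real r) ^ CARD('n))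
        \<le> ?c * (real r ^ (CARD('m) - card Z - 1) * (h r / real r) ^ CARD('n))"
      using h[of r] by (simp add: mult.assoc)
  qed
  from AE_finitely_many_small_forms[OF h this] show ?thesis by simp
qed

lemma AE_finitely_many_of_summable:
  assumes mn: "CARD('m::finite) > CARD('n::finite)" and pos: "\<And>r. 0 < r \<Longrightarrow> 0 \<le> \<psi> r"
    and sum: "summable (\<lambda>r. \<psi> (real (Suc r)) ^ CARD('n) * real (Suc r) ^ (CARD('m) - CARD('n) - 1))"
  shows "AE X :: real ^ 'n ^ 'm in lborel.
    finite {q. q \<noteq> 0 \<and> infnorm (real_vec q v* X) \<le> \<psi> (real (height q))}"
proof -
  define h where "h = (\<lambda>r::nat. if r = 0 then 0 else \<psi> (real r))"
  have h: "0 \<le> h r" for r using pos[of "real r"] by (simp add: h_def)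
  have e: "real (Suc r) ^ (CARD('m) - card ({} :: 'm set) - 1) * (h (Suc r) / real (Suc r)) ^ CARD('n)
     = \<psi> (real (Suc r)) ^ CARD('n) * real (Suc r) ^ (CARD('m) - CARD('n) - 1)" for r
  proof -
    have "CARD('m) - 1 = (CARD('m) - CARD('n) - 1) + CARD('n)" using mn by simp
    then have "real (Suc r) ^ (CARD('m) - 1) = real (Suc r) ^ (CARD('m) - CARD('n) - 1) * real (Suc r) ^ CARD('n)"
      by (metis power_add)
    then show ?thesis by (simp add: h_def power_divide)
  qed
  have "summable (\<lambda>r. real r ^ (CARD('m) - card ({} :: 'm set) - 1) * (h r / real r) ^ CARD('n))"
    by (subst summable_Suc_iff[symmetric], unfold e) (rule sum)
  from AE_finitely_many_small_forms_vanishing[OF h this]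
  have "AE X :: real ^ 'n ^ 'm in lborel. finite {q. q \<noteq> 0 \<and> infnorm (real_vec q v* X) \<le> h (height q)}"
    by simp
  moreover have "{q. q \<noteq> 0 \<and> infnorm (real_vec q v* X) \<le> h (height q)}
      = {q. q \<noteq> 0 \<and> infnorm (real_vec q v* X) \<le> \<psi> (real (height q))}" for X :: "real ^ 'n ^ 'm"
  proof -
    have "h (height q) = \<psi> (real (height q))" if "q \<noteq> 0" for q :: "int ^ 'm"
      using that height_pos_iff[of q] unfolding h_def by auto
    then show ?thesis by (intro Collect_cong conj_cong refl) simp
  qed
  ultimately show ?thesis by simp
qed

text \<open>
  Forms with \<open>q\<^sub>a = 0\<close> live on \<open>m - 1\<close> rows, and there are only \<open>O (r\<^sup>m\<^sup>-\<^sup>2)\<close> of them at height \<open>r\<close>. The bound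
  \<open>k N\<^sup>1\<^sup>-\<^sup>m\<^sup>/\<^sup>n\<close> with \<open>N = 2\<^sup>j\<^sup>n\<close> decreases in \<open>N\<close>, hence is at most \<open>h (r) = k r\<^sup>1\<^sup>-\<^sup>m\<^sup>/\<^sup>n\<close> when \<open>r \<le> N\<close>, and
  \<open>\<Sum> r\<^sup>m\<^sup>-\<^sup>2 (h (r) / r)\<^sup>n\<close> is a multiple of \<open>\<Sum> 1 / r\<^sup>2\<close>. So almost surely only finitely many such forms
  have \<open>|q X| \<le> h (r)\<close>; none of these values is \<open>0\<close>, since otherwise all multiples of \<open>q\<close> would qualify,
  and therefore the bound, which tends to \<open>0\<close>, eventually lies below all of them.
\<close>

lemma AE_no_short_forms_avoiding_coordinate:
  fixes a :: "'m::finite"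
  assumes mn: "CARD('m) > CARD('n::finite)"
  shows "AE X :: real ^ 'n ^ 'm in lborel. \<forall>k::nat. \<forall>\<^sub>F j in sequentially.
    \<forall>q. q \<noteq> 0 \<longrightarrow> q $ a = 0 \<longrightarrow> height q \<le> (2 ^ j) ^ CARD('n) \<longrightarrow>
      real k * (2 ^ j) ^ CARD('n) / (2 ^ j) ^ CARD('m) < infnorm (real_vec q v* X)"
proof (intro AE_all_countable[THEN iffD2] allI)
  fix k :: nat
  define m n where "m = CARD('m)" and "n = CARD('n)"
  have n: "0 < n" "n < m" using mn by (auto simp: m_def n_def)
  define e where "e = 1 - real m / real n"
  have e: "e < 0" using n by (simp add: e_def)
  define h where "h = (\<lambda>r::nat. real k * real r powr e)"
  have h: "0 \<le> h r" for r by (simp add: h_def)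
  have "summable (\<lambda>r. real k ^ n * (1 / real r ^ 2))"
    using inverse_power_summable[of 2, where ?'a = real] by (intro summable_mult) (simp add: divide_inverse)
  moreover have "real r ^ (m - card {a} - 1) * (h r / real r) ^ n = real k ^ n * (1 / real r ^ 2)" if "r \<ge> 1" for r
  proof -
    have "(h r / real r) ^ n = real k ^ n * (real r powr e / real r) ^ n"
      by (simp add: h_def power_mult_distrib power_divide)
    also have "real r powr e / real r = real r powr (- real m / real n)"
      using that by (simp add: e_def powr_diff powr_minus_divide)
    also have "(real r powr (- real m / real n)) ^ n = real r powr (- real m)"
      using n that by (simp add: powr_realpow[symmetric] powr_powr)
    also have "\<dots> = 1 / real r ^ m" using that by (simp add: powr_minus_divide powr_realpow)
    finally have "real r ^ (m - 2) * (h r / real r) ^ n = real k ^ n * (real r ^ (m - 2) / real r ^ m)" by simp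
    also have "real r ^ m = real r ^ (m - 2) * real r ^ 2"
    proof -
      have "m - 2 + 2 = m" using n by simp
      then show ?thesis by (metis power_add)
    qed
    finally show ?thesis using that by (simp add: numeral_2_eq_2)
  qed
  ultimately have "summable (\<lambda>r. real r ^ (m - card {a} - 1) * (h r / real r) ^ n)"
    by (subst summable_cong[where g = "\<lambda>r. real k ^ n * (1 / real r ^ 2)"]) (auto simp: eventually_sequentially)
  then have "AE X :: real ^ 'n ^ 'm in lborel.
    finite {q. (\<forall>i\<in>{a}. q $ i = 0) \<and> q \<noteq> 0 \<and> infnorm (real_vec q v* X) \<le> h (height q)}"
    unfolding m_def n_def by (intro AE_finitely_many_small_forms_vanishing[OF h])
  moreover have "AE X :: real ^ 'n ^ 'm in lborel.
    finite {q. (\<forall>i\<in>{a}. q $ i = 0) \<and> q \<noteq> 0 \<and> infnorm (real_vec q v* X) \<le> 0}"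
    by (rule AE_finitely_many_small_forms_vanishing) (use n in \<open>auto simp: n_def zero_power\<close>)
  ultimately show "AE X :: real ^ 'n ^ 'm in lborel. \<forall>\<^sub>F j in sequentially.
    \<forall>q. q \<noteq> 0 \<longrightarrow> q $ a = 0 \<longrightarrow> height q \<le> (2 ^ j) ^ CARD('n) \<longrightarrow>
      real k * (2 ^ j) ^ CARD('n) / (2 ^ j) ^ CARD('m) < infnorm (real_vec q v* X)"
  proof eventually_elim
    fix X :: "real ^ 'n ^ 'm"
    assume fin: "finite {q. (\<forall>i\<in>{a}. q $ i = 0) \<and> q \<noteq> 0 \<and> infnorm (real_vec q v* X) \<le> h (height q)}"
      and fin0: "finite {q. (\<forall>i\<in>{a}. q $ i = 0) \<and> q \<noteq> 0 \<and> infnorm (real_vec q v* X) \<le> 0}"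
    define F where "F = {q. q $ a = 0 \<and> q \<noteq> 0 \<and> infnorm (real_vec q v* X) \<le> h (height q)}"
    have finF: "finite F" using fin by (simp add: F_def)
    have pos: "0 < infnorm (real_vec q v* X)" if "q \<noteq> 0" "q $ a = 0" for q
    proof (rule ccontr)
      assume "\<not> 0 < infnorm (real_vec q v* X)"
      then have z: "real_vec q v* X = 0" using infnorm_pos_lt by blast
      define mul where "mul = (\<lambda>t::nat. (\<chi> i. int (Suc t) * q $ i) :: int ^ 'm)"
      have "inj mul"
      proof (rule injI)
        fix s t assume "mul s = mul t"
        obtain i where i: "q $ i \<noteq> 0" using \<open>q \<noteq> 0\<close> by (auto simp: vec_eq_iff)
        have "mul s $ i = mul t $ i" using \<open>mul s = mul t\<close> by simp
        then have "int (Suc s) = int (Suc t)" using i unfolding mul_def vec_lambda_beta mult_cancel_right by blast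
        then show "s = t" by simp
      qed
      moreover have "range mul \<subseteq> {q. (\<forall>i\<in>{a}. q $ i = 0) \<and> q \<noteq> 0 \<and> infnorm (real_vec q v* X) \<le> 0}"
      proof
        fix p assume "p \<in> range mul"
        then obtain t where t: "p = mul t" by blast
        have "real_vec p = real (Suc t) *\<^sub>R real_vec q"
          by (simp add: t mul_def real_vec_def vec_eq_iff)
        then have "real_vec p v* X = 0" using z scaleR_vector_matrix_assoc[of "real (Suc t)" "real_vec q" X] by simp
        moreover have "p $ a = 0" "p \<noteq> 0" using that by (auto simp: t mul_def vec_eq_iff)
        ultimately show "p \<in> {q. (\<forall>i\<in>{a}. q $ i = 0) \<and> q \<noteq> 0 \<and> infnorm (real_vec q v* X) \<le> 0}"
          by (simp add: infnorm_0)
      qed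
      ultimately show False using finite_subset[OF _ fin0] range_inj_infinite by blast
    qed
    have "\<exists>\<mu>>0. \<forall>q\<in>F. \<mu> \<le> infnorm (real_vec q v* X)"
    proof (cases "F = {}")
      case False
      have "0 < Min ((\<lambda>q. infnorm (real_vec q v* X)) ` F)"
        using finF False pos by (subst Min_gr_iff) (auto simp: F_def)
      then show ?thesis using finF by (intro exI[of _ "Min ((\<lambda>q. infnorm (real_vec q v* X)) ` F)"]) auto
    qed (auto intro: exI[of _ 1])
    then obtain \<mu> where \<mu>: "\<mu> > 0" "\<And>q. q \<in> F \<Longrightarrow> \<mu> \<le> infnorm (real_vec q v* X)" by blast
    have lim: "(\<lambda>j. real k * (1/2) ^ j) \<longlonglongrightarrow> 0"
      by (intro tendsto_mult_right_zero LIMSEQ_power_zero) simp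
    have "\<forall>\<^sub>F j in sequentially. real k * (1/2) ^ j < \<mu>" using order_tendstoD(2)[OF lim \<mu>(1)] .
    then show "\<forall>\<^sub>F j in sequentially.
      \<forall>q. q \<noteq> 0 \<longrightarrow> q $ a = 0 \<longrightarrow> height q \<le> (2 ^ j) ^ CARD('n) \<longrightarrow>
      real k * (2 ^ j) ^ CARD('n) / (2 ^ j) ^ CARD('m) < infnorm (real_vec q v* X)"
    proof (eventually_elim, intro allI impI)
      fix j q assume j: "real k * (1/2) ^ j < \<mu>" and q: "q \<noteq> 0" "q $ a = 0" "height q \<le> (2 ^ j) ^ CARD('n)"
      define \<delta> :: real where "\<delta> = real k * (2 ^ j) ^ n / (2 ^ j) ^ m"
      have "\<delta> \<le> real k * (1/2) ^ j"
      proof -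
        have "((2::real) ^ j) ^ m \<ge> (2 ^ j) ^ Suc n" using n by (intro power_increasing) auto
        then have "(2 ^ j) ^ n / ((2::real) ^ j) ^ m \<le> (2 ^ j) ^ n / (2 ^ j) ^ Suc n"
          by (intro divide_left_mono) auto
        also have "\<dots> = (1/2) ^ j" by (simp add: power_one_over)
        finally have "real k * ((2 ^ j) ^ n / (2 ^ j) ^ m) \<le> real k * (1/2) ^ j" by (intro mult_left_mono) auto
        then show ?thesis by (simp add: \<delta>_def)
      qed
      then have d: "\<delta> < \<mu>" using j by simp
      have dh: "\<delta> \<le> h (height q)"
      proof -
        have hq: "0 < height q" using q height_pos_iff by blast
        have "(((2::real) ^ j) ^ n) powr e \<le> real (height q) powr e"
        proof (rule powr_mono2')
          show "real (height q) \<le> (2 ^ j) ^ n"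
            using q(3) of_nat_mono[of "height q" "(2 ^ j) ^ n"] by (simp add: n_def)
        qed (use e hq in auto)
        moreover have "(((2::real) ^ j) ^ n) powr e = (2 ^ j) ^ n / (2 ^ j) ^ m"
        proof -
          have "(((2::real) ^ j) ^ n) powr (real m / real n) = (2 ^ j) ^ m"
            using n by (simp add: powr_realpow[symmetric] powr_powr)
          then show ?thesis by (simp add: e_def powr_diff)
        qed
        ultimately have "real k * ((2 ^ j) ^ n / (2 ^ j) ^ m) \<le> real k * real (height q) powr e"
          by (intro mult_left_mono) auto
        then show ?thesis by (simp add: \<delta>_def h_def)
      qed
      have "\<delta> < infnorm (real_vec q v* X)"
      proof (rule ccontr)
        assume *: "\<not> \<delta> < infnorm (real_vec q v* X)"
        then have "q \<in> F" using q dh by (simp add: F_def)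
        then show False using \<mu>(2)[of q] d * by simp
      qed
      then show "real k * (2 ^ j) ^ CARD('n) / (2 ^ j) ^ CARD('m) < infnorm (real_vec q v* X)"
        by (simp add: \<delta>_def m_def n_def)
    qed
  qed
qed

section \<open>Nonsingular blocks of rows\<close>

text \<open>
  The determinant is a polynomial in \<open>t\<close>, and it is not the zero polynomial because \<open>M + t I\<close> is injective
  as soon as \<open>t\<close> exceeds a bound \<open>K\<close> for the operator norm of \<open>M\<close>.
\<close>

lemma finite_singular_shifts:
  fixes M :: "real ^ 'n ^ 'n"
  shows "finite {t. det (M + t *\<^sub>R mat 1) = 0}"
proof -
  define p where "p = det ((\<chi> i j. [:M $ i $ j, mat 1 $ i $ j:]) :: real poly ^ 'n ^ 'n)"
  have p: "poly p t = det (M + t *\<^sub>R mat 1)" for t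
    unfolding p_def det_def
    by (simp add: poly_sum poly_prod)
  obtain K where K: "K > 0" "\<And>x. norm (M *v x) \<le> K * norm x"
    using linear_bounded_pos[OF matrix_vector_mul_linear[of M]] by blast
  have "det (M + (K + 1) *\<^sub>R mat 1) \<noteq> 0"
  proof -
    have "x = 0" if x: "(M + (K + 1) *\<^sub>R mat 1) *v x = 0" for x
    proof -
      have "(M + (K + 1) *\<^sub>R mat 1) *v x = M *v x + (K + 1) *\<^sub>R x"
        by (simp add: matrix_vector_mult_add_rdistrib scaleR_matrix_vector_assoc[symmetric])
      then have "M *v x = - ((K + 1) *\<^sub>R x)" using x by (simp add: eq_neg_iff_add_eq_0)
      then have "(K + 1) * norm x \<le> K * norm x" using K(2)[of x] K(1) by simp
      then show ?thesis by (simp add: algebra_simps)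
    qed
    then show ?thesis
      using matrix_left_invertible_ker invertible_left_inverse invertible_det_nz by blast
  qed
  then have "p \<noteq> 0" using p[of "K + 1"] by auto
  then show ?thesis using poly_roots_finite[of p] by (simp add: p)
qed

definition row_block :: "('n \<Rightarrow> 'm) \<Rightarrow> real ^ 'n ^ 'm \<Rightarrow> real ^ 'n ^ 'n" where
  "row_block \<sigma> X = (\<chi> i. X $ \<sigma> i)"

lemma continuous_on_det_row_block: "continuous_on A (\<lambda>X. det (row_block \<sigma> X))"
  unfolding det_def row_block_def by (simp) (intro continuous_intros)

text \<open>
  Translating \<open>X\<close> by multiples of a matrix \<open>J\<close> with identity block shifts the block by multiples of the
  identity, so each such line meets the singular set in finitely many points only.
\<close>

lemma AE_row_block_nonsingular:
  fixes \<sigma> :: "'n::finite \<Rightarrow> 'm::finite"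
  assumes "inj \<sigma>"
  shows "AE X :: real ^ 'n ^ 'm in lborel. det (row_block \<sigma> X) \<noteq> 0"
proof (rule AE_of_AE_translates)
  define J :: "real ^ 'n ^ 'm" where "J = (\<chi> k. if k \<in> range \<sigma> then axis (inv \<sigma> k) 1 else 0)"
  have J: "row_block \<sigma> J = mat 1"
    using assms by (simp add: row_block_def J_def mat_def axis_def vec_eq_iff)
  have "open {X :: real ^ 'n ^ 'm. det (row_block \<sigma> X) \<noteq> 0}"
    by (intro open_Collect_neq continuous_on_det_row_block continuous_on_const)
  then show "{X :: real ^ 'n ^ 'm. det (row_block \<sigma> X) \<noteq> 0} \<in> sets borel" by simp
  show "(\<lambda>t. t *\<^sub>R J) \<in> borel_measurable borel" by simp
  have "row_block \<sigma> (X + t *\<^sub>R J) = row_block \<sigma> X + t *\<^sub>R mat 1" for X t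
    unfolding J[symmetric] by (simp add: row_block_def vec_eq_iff)
  then have "finite {t. det (row_block \<sigma> (X + t *\<^sub>R J)) = 0}" for X
    using finite_singular_shifts[of "row_block \<sigma> X"] by simp
  then have "AE t in lborel. t \<notin> {t. det (row_block \<sigma> (X + t *\<^sub>R J)) = 0}" for X
    by (intro AE_not_in finite_imp_null_set_lborel)
  then show "AE X in lborel. AE t in lborel. det (row_block \<sigma> (X + t *\<^sub>R J)) \<noteq> 0"
    by simp
qed

lemma nonsingular_infnorm_lower_bound:
  fixes M :: "real ^ 'n ^ 'n"
  assumes "det M \<noteq> 0"
  shows "\<exists>\<kappa>>0. \<forall>u. \<kappa> * infnorm u \<le> infnorm (u v* M)"
proof -
  have "invertible (transpose M)" using assms by (simp add: invertible_det_nz det_transpose)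
  then have "inj ((*v) (transpose M))" by (rule inj_matrix_vector_mult)
  then obtain B where B: "B > 0" "\<And>x. B * norm x \<le> norm (transpose M *v x)"
    using linear_inj_bounded_below_pos[OF matrix_vector_mul_linear[of "transpose M"]] by blast
  have c: "sqrt (real CARD('n)) > 0" by simp
  have "B / sqrt (real CARD('n)) * infnorm u \<le> infnorm (u v* M)" for u
  proof -
    have "B * infnorm u \<le> B * norm u" using B(1) infnorm_le_norm[of u] by (intro mult_left_mono) auto
    also have "\<dots> \<le> norm (u v* M)" using B(2)[of u] by simp
    also have "\<dots> \<le> sqrt (real CARD('n)) * infnorm (u v* M)" using norm_le_infnorm[of "u v* M"] by simp
    finally show ?thesis using c by (simp add: divide_le_eq pos_divide_le_eq algebra_simps)
  qed
  then show ?thesis using B(1) c by (intro exI[of _ "B / sqrt (real CARD('n))"]) auto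
qed

section \<open>Short forms by the pigeonhole principle\<close>

lemma real_vec_diff: "real_vec (p - q) = real_vec p - real_vec q"
  by (simp add: real_vec_def vec_eq_iff)

text \<open>
  All \<open>(N + 1)\<^sup>m\<close> vectors with entries in \<open>{0..N}\<close>, \<open>N = T\<^sup>n\<close>, have values in the open cube of half side
  \<open>L = m A N\<close>. Dividing it into \<open>M\<^sup>n\<close> cells with \<open>M = T\<^sup>m\<close> gives \<open>M\<^sup>n = N\<^sup>m\<close>, fewer cells than vectors, and
  two vectors in a common cell differ by the required form. Taking \<open>N\<close> to be an \<open>n\<close>-th power keeps the
  number of cells in each direction an integer.
\<close>

lemma exists_short_form:
  fixes X :: "real ^ 'n ^ 'm"
  assumes X: "\<And>i j. \<bar>X $ i $ j\<bar> < A" and T: "1 \<le> T"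
  shows "\<exists>q. q \<noteq> 0 \<and> height q \<le> T ^ CARD('n) \<and>
    infnorm (real_vec q v* X) \<le> 2 * real CARD('m) * A * real T ^ CARD('n) / real T ^ CARD('m)"
proof -
  define N M where "N = T ^ CARD('n)" and "M = T ^ CARD('m)"
  have NM: "1 \<le> N" "1 \<le> M" using T by (auto simp: N_def M_def)
  have A: "A > 0" using X abs_ge_zero le_less_trans by blast
  define L where "L = real CARD('m) * A * real N"
  have L: "L > 0" using A NM by (simp add: L_def)
  define D where "D = {q :: int ^ 'm. \<forall>i. q $ i \<in> {0..int N}}"
  define E where "E = {c :: int ^ 'n. \<forall>j. c $ j \<in> {0..<int M}}"
  define cell where "cell = (\<lambda>q :: int ^ 'm. (\<chi> j. \<lfloor>((real_vec q v* X) $ j + L) * real M / (2 * L)\<rfloor>) :: int ^ 'n)"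
  have bound: "\<bar>(real_vec q v* X) $ j\<bar> < L" if "q \<in> D" for q j
  proof -
    have "\<bar>(real_vec q v* X) $ j\<bar> \<le> (\<Sum>i\<in>UNIV. \<bar>X $ i $ j * real_of_int (q $ i)\<bar>)"
      unfolding vector_matrix_mult_def real_vec_def by (simp add: mult.commute)
    also have "\<dots> < (\<Sum>i\<in>(UNIV::'m set). A * real N)"
    proof (rule sum_strict_mono)
      fix i
      have q: "0 \<le> q $ i" "q $ i \<le> int N" using that by (auto simp: D_def)
      have "\<bar>X $ i $ j * real_of_int (q $ i)\<bar> = \<bar>X $ i $ j\<bar> * real_of_int (q $ i)"
        using q by (simp add: abs_mult)
      also have "\<dots> \<le> \<bar>X $ i $ j\<bar> * real N"
      proof (rule mult_left_mono)
          show "real_of_int (q $ i) \<le> real N" using q(2) by linarith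
        qed simp
      also have "\<dots> < A * real N" using X[of i j] NM by (intro mult_strict_right_mono) auto
      finally show "\<bar>X $ i $ j * real_of_int (q $ i)\<bar> < A * real N" .
    qed auto
    also have "\<dots> = L" by (simp add: L_def)
    finally show ?thesis .
  qed
  have cellE: "cell ` D \<subseteq> E"
  proof
    fix c assume "c \<in> cell ` D"
    then obtain q where q: "q \<in> D" "c = cell q" by blast
    have "0 \<le> \<lfloor>((real_vec q v* X) $ j + L) * real M / (2 * L)\<rfloor> \<and>
       \<lfloor>((real_vec q v* X) $ j + L) * real M / (2 * L)\<rfloor> < int M" for j
    proof -
      have b: "0 \<le> (real_vec q v* X) $ j + L" "(real_vec q v* X) $ j + L < 2 * L"
        using bound[OF q(1), of j] by auto
      have "((real_vec q v* X) $ j + L) * real M < 2 * L * real M"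
        using b NM by (intro mult_strict_right_mono) auto
      then have "((real_vec q v* X) $ j + L) * real M / (2 * L) < real M"
        using L by (simp add: pos_divide_less_eq mult.commute)
      moreover have "0 \<le> ((real_vec q v* X) $ j + L) * real M / (2 * L)" using b L by simp
      ultimately show ?thesis by (simp add: floor_less_iff)
    qed
    then show "c \<in> E" by (simp add: q(2) cell_def E_def)
  qed
  have "card E < card D"
  proof -
    have "card E = M ^ CARD('n)" unfolding E_def by (subst card_int_vec_box(2)) auto
    also have "\<dots> = N ^ CARD('m)" by (simp add: M_def N_def power_mult[symmetric] mult.commute)
    also have "\<dots> < (N + 1) ^ CARD('m)" by (intro power_strict_mono) auto
    also have "\<dots> = card D" unfolding D_def by (subst card_int_vec_box(2)) (auto simp: nat_add_distrib)
    finally show ?thesis .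
  qed
  moreover have "finite E" unfolding E_def by (rule card_int_vec_box(1)) simp
  ultimately have "\<not> inj_on cell D" using cellE by (metis card_inj_on_le not_le)
  then obtain p q where pq: "p \<in> D" "q \<in> D" "p \<noteq> q" "cell p = cell q" by (auto simp: inj_on_def)
  have "height (p - q) \<le> N"
    unfolding height_le_iff
  proof
    fix i
    have "0 \<le> p $ i" "p $ i \<le> int N" "0 \<le> q $ i" "q $ i \<le> int N" using pq(1,2) by (auto simp: D_def)
    then show "\<bar>(p - q) $ i\<bar> \<le> int N" by simp
  qed
  moreover have "infnorm (real_vec (p - q) v* X) \<le> 2 * L / real M"
    unfolding infnorm_le_iff
  proof
    fix j
    define s t where "s = (real_vec p v* X) $ j" and "t = (real_vec q v* X) $ j"
    have "\<lfloor>(s + L) * real M / (2 * L)\<rfloor> = \<lfloor>(t + L) * real M / (2 * L)\<rfloor>"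
      using pq(4) by (simp add: cell_def vec_eq_iff s_def t_def)
    then have "\<bar>(s + L) * real M / (2 * L) - (t + L) * real M / (2 * L)\<bar> < 1"
      by linarith
    also have "(s + L) * real M / (2 * L) - (t + L) * real M / (2 * L) = (s - t) * (real M / (2 * L))"
      by (simp add: diff_divide_distrib[symmetric] algebra_simps)
    finally have "\<bar>s - t\<bar> * (real M / (2 * L)) < 1" using L by (simp add: abs_mult)
    then have "\<bar>s - t\<bar> \<le> 2 * L / real M" using L NM by (simp add: field_simps)
    then show "\<bar>(real_vec (p - q) v* X) $ j\<bar> \<le> 2 * L / real M"
      by (simp add: real_vec_diff algebra_simps s_def t_def)
  qed
  ultimately show ?thesis using pq(3)
    by (intro exI[of _ "p - q"]) (simp add: N_def M_def L_def mult.assoc)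
qed

section \<open>Forms with a small distinguished coordinate\<close>

lemma card_le_of_fibres:
  fixes b :: real
  assumes fin: "finite S" and img: "f ` S \<subseteq> V" "finite V" and b: "0 \<le> b"
    and fib: "\<And>v. v \<in> V \<Longrightarrow> real (card {x\<in>S. f x = v}) \<le> b"
  shows "real (card S) \<le> real (card V) * b"
proof -
  have "real (card S) = (\<Sum>v\<in>f ` S. \<Sum>x\<in>{x\<in>S. f x = v}. 1)"
    using sum.image_gen[OF fin, of "\<lambda>_. 1 :: real" f] by simp
  also have "\<dots> = (\<Sum>v\<in>f ` S. real (card {x\<in>S. f x = v}))" by simp
  also have "\<dots> \<le> (\<Sum>v\<in>f ` S. b)" using fib img(1) by (intro sum_mono) auto
  also have "\<dots> = real (card (f ` S)) * b" by simp
  also have "\<dots> \<le> real (card V) * b" using img b by (intro mult_right_mono of_nat_mono card_mono) auto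
  finally show ?thesis .
qed

text \<open>
  The \<open>m - n - 1\<close> coordinates outside \<open>a\<close> and the range of \<open>\<sigma>\<close> are arbitrary. Once they are fixed, two
  admissible vectors differ by a vector \<open>u\<close> supported on the range of \<open>\<sigma>\<close> whose image under the
  nonsingular block has norm at most \<open>2 H\<close>, so each remaining coordinate lies in an interval of length
  \<open>4 H / \<kappa>\<close>.
\<close>

lemma card_forms_near_point_le:
  fixes X :: "real ^ 'n ^ 'm" and \<sigma> :: "'n \<Rightarrow> 'm"
  assumes \<sigma>: "inj \<sigma>" "a \<notin> range \<sigma>" and \<kappa>: "0 < \<kappa>" "\<And>u. \<kappa> * infnorm u \<le> infnorm (u v* row_block \<sigma> X)"
    and H: "0 \<le> H"
  shows "real (card {q. height q \<le> N \<and> q $ a = s \<and> infnorm (real_vec q v* X + w) \<le> H})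
     \<le> (2 * real N + 1) ^ (CARD('m) - CARD('n) - 1) * (4 * H / \<kappa> + 1) ^ CARD('n)"
proof -
  define S where "S = {q. height q \<le> N \<and> q $ a = s \<and> infnorm (real_vec q v* X + w) \<le> H}"
  define R where "R = - insert a (range \<sigma>)"
  define f where "f = (\<lambda>q :: int ^ 'm. (\<chi> i. if i \<in> R then q $ i else 0) :: int ^ 'm)"
  define F where "F = (\<lambda>i. if i \<in> R then {- int N..int N} else {0})"
  define V where "V = {v :: int ^ 'm. \<forall>i. v $ i \<in> F i}"
  define b where "b = 2 * H / \<kappa>"
  have b: "0 \<le> b" using H \<kappa> by (simp add: b_def)
  have finF: "finite (F i)" for i by (simp add: F_def)
  have finS: "finite S" by (rule finite_subset[OF _ finite_height_le[of N]]) (auto simp: S_def)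
  have finV: "finite V" unfolding V_def using finF by (rule card_int_vec_box(1))
  have cardR: "card R = CARD('m) - CARD('n) - 1"
    unfolding R_def using \<sigma> by (simp add: Compl_eq_Diff_UNIV card_Diff_subset card_image)
  have cardV: "real (card V) = (2 * real N + 1) ^ (CARD('m) - CARD('n) - 1)"
  proof -
    have "card V = (\<Prod>i\<in>UNIV. card (F i))" unfolding V_def using finF by (rule card_int_vec_box(2))
    also have "\<dots> = (\<Prod>i\<in>R. card (F i))" by (rule prod.mono_neutral_right) (auto simp: F_def)
    also have "\<dots> = (\<Prod>i\<in>R. 2 * N + 1)" by (rule prod.cong) (auto simp: F_def)
    also have "\<dots> = (2 * N + 1) ^ card R" by simp
    finally show ?thesis by (simp add: cardR add.commute)
  qed
  have img: "f ` S \<subseteq> V"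
  proof
    fix v assume "v \<in> f ` S"
    then obtain q where q: "q \<in> S" "v = f q" by blast
    have "\<bar>q $ i\<bar> \<le> int N" for i using q(1) by (simp add: S_def height_le_iff)
    then have "- int N \<le> q $ i \<and> q $ i \<le> int N" for i by (metis abs_le_iff minus_le_iff)
    then show "v \<in> V" by (auto simp: V_def F_def q(2) f_def)
  qed
  have fib: "real (card {q\<in>S. f q = v}) \<le> (2 * b + 1) ^ CARD('n)" for v
  proof (cases "{q\<in>S. f q = v} = {}")
    case False
    then obtain q0 where q0: "q0 \<in> S" "f q0 = v" by blast
    define G where "G = {c :: int ^ 'n. \<forall>i. c $ i \<in> {q0 $ \<sigma> i - \<lfloor>b\<rfloor>..q0 $ \<sigma> i + \<lfloor>b\<rfloor>}}"
    define g where "g = (\<lambda>q :: int ^ 'm. (\<chi> i. q $ \<sigma> i) :: int ^ 'n)"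
    have agree: "q $ i = q0 $ i" if "q \<in> S" "f q = v" "i \<notin> range \<sigma>" for q i
    proof (cases "i = a")
      case True
      then show ?thesis using that q0 by (simp add: S_def)
    next
      case False
      then have "i \<in> R" using that by (simp add: R_def)
      moreover have "f q $ i = f q0 $ i" using that q0 by simp
      ultimately show ?thesis by (simp add: f_def)
    qed
    have inj: "inj_on g {q\<in>S. f q = v}"
    proof (rule inj_onI)
      fix p q assume p: "p \<in> {q\<in>S. f q = v}" and q: "q \<in> {q\<in>S. f q = v}" and pq: "g p = g q"
      have "p $ i = q $ i" for i
      proof (cases "i \<in> range \<sigma>")
        case True
        then obtain k where "i = \<sigma> k" by blast
        moreover have "g p $ k = g q $ k" using pq by simp
        ultimately show ?thesis by (simp add: g_def)
      next
        case False
        then show ?thesis using agree[of p i] agree[of q i] p q by simp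
      qed
      then show "p = q" by (simp add: vec_eq_iff)
    qed
    have sub: "g ` {q\<in>S. f q = v} \<subseteq> G"
    proof
      fix c assume "c \<in> g ` {q\<in>S. f q = v}"
      then obtain q where q: "q \<in> S" "f q = v" "c = g q" by blast
      define u :: "real ^ 'n" where "u = (\<chi> k. real_of_int (q $ \<sigma> k - q0 $ \<sigma> k))"
      have "u v* row_block \<sigma> X = real_vec q v* X - real_vec q0 v* X"
      proof -
        have "(\<Sum>i\<in>UNIV. real_of_int (q $ i - q0 $ i) * X $ i $ j)
            = (\<Sum>k\<in>UNIV. real_of_int (q $ \<sigma> k - q0 $ \<sigma> k) * X $ \<sigma> k $ j)" for j
        proof -
          have "(\<Sum>i\<in>UNIV. real_of_int (q $ i - q0 $ i) * X $ i $ j)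
              = (\<Sum>i\<in>range \<sigma>. real_of_int (q $ i - q0 $ i) * X $ i $ j)"
            using agree[OF q(1,2)] by (intro sum.mono_neutral_right) auto
          then show ?thesis using \<sigma>(1) by (simp add: sum.reindex)
        qed
        then have "u v* row_block \<sigma> X = (real_vec q - real_vec q0) v* X"
          by (simp add: vec_eq_iff vector_matrix_mult_def u_def row_block_def real_vec_def mult.commute)
        then show ?thesis by (simp add: algebra_simps)
      qed
      also have "real_vec q v* X - real_vec q0 v* X = (real_vec q v* X + w) + - (real_vec q0 v* X + w)" by simp
      finally have "infnorm (u v* row_block \<sigma> X) \<le> infnorm (real_vec q v* X + w) + infnorm (real_vec q0 v* X + w)"
        using infnorm_triangle[of "real_vec q v* X + w" "- (real_vec q0 v* X + w)"]
        by (simp only: infnorm_neg)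
      also have "\<dots> \<le> 2 * H" using q(1) q0(1) by (simp add: S_def)
      finally have "\<kappa> * infnorm u \<le> 2 * H" using \<kappa>(2)[of u] by simp
      then have "infnorm u \<le> b" using \<kappa>(1) by (simp add: b_def pos_le_divide_eq mult.commute)
      then have ub: "\<bar>real_of_int (q $ \<sigma> k - q0 $ \<sigma> k)\<bar> \<le> b" for k
        using component_le_infnorm_cart[of u k] by (simp add: u_def)
      have "q $ \<sigma> k \<in> {q0 $ \<sigma> k - \<lfloor>b\<rfloor>..q0 $ \<sigma> k + \<lfloor>b\<rfloor>}" for k
      proof -
        have "real_of_int (q $ \<sigma> k - q0 $ \<sigma> k) \<le> b" "real_of_int (q0 $ \<sigma> k - q $ \<sigma> k) \<le> b"
          using ub[of k] by auto
        then have "q $ \<sigma> k - q0 $ \<sigma> k \<le> \<lfloor>b\<rfloor>" "q0 $ \<sigma> k - q $ \<sigma> k \<le> \<lfloor>b\<rfloor>" by (simp_all only: le_floor_iff)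
        then show ?thesis by simp
      qed
      then show "c \<in> G" by (simp add: G_def q(3) g_def)
    qed
    have finG: "finite G" unfolding G_def by (rule card_int_vec_box(1)) simp
    have cardG: "card G = nat (2 * \<lfloor>b\<rfloor> + 1) ^ CARD('n)"
      unfolding G_def by (subst card_int_vec_box(2)) auto
    have "card {q\<in>S. f q = v} \<le> card G" using card_inj_on_le[OF inj sub finG] .
    then have "real (card {q\<in>S. f q = v}) \<le> real (card G)" by (rule of_nat_mono)
    also have "\<dots> = (real_of_int (2 * \<lfloor>b\<rfloor> + 1)) ^ CARD('n)" using b by (simp add: cardG)
    also have "\<dots> \<le> (2 * b + 1) ^ CARD('n)" using b by (intro power_mono) auto
    finally show ?thesis .
  next
    case True
    then have "card {q\<in>S. f q = v} = 0" by (simp only: card.empty)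
    then show ?thesis using b by simp
  qed
  have "real (card S) \<le> real (card V) * (2 * b + 1) ^ CARD('n)"
    by (rule card_le_of_fibres[OF finS img finV _ fib]) (use b in auto)
  then show ?thesis by (simp add: cardV S_def b_def)
qed

lemma measure_strip:
  fixes u :: "real ^ 'n"
  assumes "s \<noteq> 0" "0 \<le> h"
  shows "{y. infnorm (u + s *\<^sub>R y) \<le> h} \<in> fmeasurable lborel"
    and "measure lborel {y. infnorm (u + s *\<^sub>R y) \<le> h} = (2 * h / \<bar>s\<bar>) ^ CARD('n)"
  using emeasure_strip[OF assms, of u] assms
  by (auto simp: fmeasurable_def measure_def strip_eq_cbox)

text \<open>
  This set contains every row \<open>y\<close> within distance \<open>R\<close> of \<open>y0\<close> such that some \<open>q\<close> of height at most \<open>N\<close> with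
  \<open>0 < |q\<^sub>a| \<le> \<epsilon> N\<close> takes a value of size at most \<open>\<delta>\<close> at \<open>X + axis a y\<close>. The last condition on \<open>q\<close> follows
  from the triangle inequality; it records that the point \<open>y\<close> with value \<open>0\<close> lies near the ball around \<open>y0\<close>,
  which keeps the number of such \<open>q\<close> small.
\<close>

definition small_coordinate_set ::
    "real ^ 'n ^ 'm \<Rightarrow> 'm \<Rightarrow> real ^ 'n \<Rightarrow> real \<Rightarrow> real \<Rightarrow> nat \<Rightarrow> real \<Rightarrow> (real ^ 'n) set" where
  "small_coordinate_set X a y0 R \<epsilon> N \<delta> = (\<Union>q\<in>{q. q $ a \<noteq> 0 \<and> height q \<le> N \<and> \<bar>real_of_int (q $ a)\<bar> \<le> \<epsilon> * real N
       \<and> infnorm (real_vec q v* X + of_int (q $ a) *\<^sub>R y0) \<le> \<delta> + \<bar>real_of_int (q $ a)\<bar> * R}.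
     {y. infnorm (real_vec q v* X + of_int (q $ a) *\<^sub>R y) \<le> \<delta>})"

text \<open>
  For each value \<open>s\<close> of \<open>q\<^sub>a\<close> the counting lemma bounds the number of \<open>q\<close>, and each contributes a cube of
  side \<open>2 \<delta> / |s|\<close>. That number grows at most like \<open>|s|\<^sup>n\<close>, which is compensated by the volume factor
  \<open>|s|\<^sup>-\<^sup>n\<close>, so all \<open>s\<close> obey the same bound, and there are at most \<open>2 \<epsilon> N\<close> of them.
\<close>

lemma measure_small_coordinate_set_le:
  fixes X :: "real ^ 'n ^ 'm" and \<sigma> :: "'n \<Rightarrow> 'm"
  assumes \<sigma>: "inj \<sigma>" "a \<notin> range \<sigma>" and \<kappa>: "0 < \<kappa>" "\<And>u. \<kappa> * infnorm u \<le> infnorm (u v* row_block \<sigma> X)"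
    and pos: "0 \<le> \<delta>" "0 \<le> R" "0 \<le> \<epsilon>" "1 \<le> N"
  shows "small_coordinate_set X a y0 R \<epsilon> N \<delta> \<in> fmeasurable lborel"
    and "measure lborel (small_coordinate_set X a y0 R \<epsilon> N \<delta>)
     \<le> 2 * \<epsilon> * real N * ((3 * real N) ^ (CARD('m) - CARD('n) - 1) * (2 * \<delta> * (4 * (\<delta> + R) / \<kappa> + 1)) ^ CARD('n))"
proof -
  define I where "I = {s::int. s \<noteq> 0 \<and> \<bar>real_of_int s\<bar> \<le> \<epsilon> * real N}"
  define Q where "Q = (\<lambda>s. {q. height q \<le> N \<and> q $ a = s \<and> infnorm (real_vec q v* X + of_int s *\<^sub>R y0) \<le> \<delta> + \<bar>real_of_int s\<bar> * R})"
  define B where "B = (\<lambda>s q. {y. infnorm (real_vec q v* X + of_int s *\<^sub>R y) \<le> \<delta>})"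
  have eq: "small_coordinate_set X a y0 R \<epsilon> N \<delta> = (\<Union>s\<in>I. \<Union>q\<in>Q s. B s q)"
    by (auto simp: small_coordinate_set_def I_def Q_def B_def)
  have I: "I \<subseteq> {- \<lfloor>\<epsilon> * real N\<rfloor>..\<lfloor>\<epsilon> * real N\<rfloor>} - {0}"
    by (auto simp: I_def le_floor_iff abs_le_iff) linarith
  have finI: "finite I" by (rule finite_subset[OF I]) simp
  have cardI: "real (card I) \<le> 2 * \<epsilon> * real N"
  proof -
    have fl: "0 \<le> \<lfloor>\<epsilon> * real N\<rfloor>" using pos by simp
    have "card I \<le> card ({- \<lfloor>\<epsilon> * real N\<rfloor>..\<lfloor>\<epsilon> * real N\<rfloor>} - {0})" by (rule card_mono[OF _ I]) simp
    also have "\<dots> = nat (2 * \<lfloor>\<epsilon> * real N\<rfloor>)" using fl by (simp add: card_Diff_singleton_if)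
    finally have "real (card I) \<le> real (nat (2 * \<lfloor>\<epsilon> * real N\<rfloor>))" by (rule of_nat_mono)
    also have "\<dots> \<le> 2 * (\<epsilon> * real N)" using fl by simp
    finally show ?thesis by simp
  qed
  have finQ: "finite (Q s)" for s by (rule finite_subset[OF _ finite_height_le[of N]]) (auto simp: Q_def)
  have Bm: "B s q \<in> fmeasurable lborel" if "s \<in> I" for s q
    using that pos unfolding B_def I_def by (intro measure_strip(1)) auto
  show "small_coordinate_set X a y0 R \<epsilon> N \<delta> \<in> fmeasurable lborel"
    unfolding eq using finI finQ Bm by (intro fmeasurable.finite_UN) auto
  define c where "c = (3 * real N) ^ (CARD('m) - CARD('n) - 1) * (2 * \<delta> * (4 * (\<delta> + R) / \<kappa> + 1)) ^ CARD('n)"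
  have per_s: "measure lborel (\<Union>q\<in>Q s. B s q) \<le> c" if s: "s \<in> I" for s
  proof -
    have s1: "1 \<le> \<bar>real_of_int s\<bar>" 
    proof -
      have "s \<noteq> 0" using s by (simp add: I_def)
      then have "1 \<le> \<bar>s\<bar>" by simp
      then show ?thesis by linarith
    qed
    define t where "t = \<bar>real_of_int s\<bar>"
    have t: "1 \<le> t" using s1 by (simp add: t_def)
    have "measure lborel (\<Union>q\<in>Q s. B s q) \<le> (\<Sum>q\<in>Q s. measure lborel (B s q))"
      using finQ Bm[OF s, THEN fmeasurableD] by (intro measure_UNION_le) auto
    also have "\<dots> = (\<Sum>q\<in>Q s. (2 * \<delta> / t) ^ CARD('n))"
      unfolding B_def t_def using s1 pos by (intro sum.cong refl measure_strip(2)) auto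
    also have "\<dots> = real (card (Q s)) * (2 * \<delta> / t) ^ CARD('n)" by simp
    also have "\<dots> \<le> ((2 * real N + 1) ^ (CARD('m) - CARD('n) - 1) * (4 * (\<delta> + t * R) / \<kappa> + 1) ^ CARD('n)) * (2 * \<delta> / t) ^ CARD('n)"
    proof (rule mult_right_mono)
      show "real (card (Q s)) \<le> (2 * real N + 1) ^ (CARD('m) - CARD('n) - 1) * (4 * (\<delta> + t * R) / \<kappa> + 1) ^ CARD('n)"
        unfolding Q_def t_def using pos by (intro card_forms_near_point_le[OF \<sigma> \<kappa>]) auto
    qed (use pos t in auto)
    also have "\<dots> = (2 * real N + 1) ^ (CARD('m) - CARD('n) - 1) * ((4 * (\<delta> + t * R) / \<kappa> + 1) * (2 * \<delta> / t)) ^ CARD('n)"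
      by (simp only: power_mult_distrib mult.assoc)
    also have "\<dots> \<le> c"
      unfolding c_def
    proof (rule mult_mono[OF power_mono power_mono])
      show "(4 * (\<delta> + t * R) / \<kappa> + 1) * (2 * \<delta> / t) \<le> 2 * \<delta> * (4 * (\<delta> + R) / \<kappa> + 1)"
      proof -
        have "\<delta> + t * R \<le> t * (\<delta> + R)" using mult_right_mono[OF t pos(1)] by (simp add: algebra_simps)
        then have "4 * (\<delta> + t * R) / \<kappa> \<le> 4 * (t * (\<delta> + R)) / \<kappa>"
          using \<kappa>(1) by (intro divide_right_mono mult_left_mono) auto
        then have "4 * (\<delta> + t * R) / \<kappa> + 1 \<le> t * (4 * (\<delta> + R) / \<kappa> + 1)"
          using t by (simp add: algebra_simps)
        then have "(4 * (\<delta> + t * R) / \<kappa> + 1) * (2 * \<delta> / t) \<le> t * (4 * (\<delta> + R) / \<kappa> + 1) * (2 * \<delta> / t)"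
          using pos t by (intro mult_right_mono) auto
        also have "\<dots> = 2 * \<delta> * (4 * (\<delta> + R) / \<kappa> + 1)" using t by simp
        finally show ?thesis .
      qed
    qed (use pos t \<kappa>(1) in auto)
    finally show ?thesis .
  qed
  have "measure lborel (small_coordinate_set X a y0 R \<epsilon> N \<delta>) \<le> (\<Sum>s\<in>I. measure lborel (\<Union>q\<in>Q s. B s q))"
    unfolding eq using finI finQ Bm by (intro measure_UNION_le fmeasurableD fmeasurable.finite_UN) auto
  also have "\<dots> \<le> (\<Sum>s\<in>I. c)" using per_s by (rule sum_mono)
  also have "\<dots> = real (card I) * c" by simp
  also have "\<dots> \<le> 2 * \<epsilon> * real N * c"
    using cardI pos \<kappa>(1) by (intro mult_right_mono) (auto simp: c_def)
  finally show "measure lborel (small_coordinate_set X a y0 R \<epsilon> N \<delta>)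
     \<le> 2 * \<epsilon> * real N * ((3 * real N) ^ (CARD('m) - CARD('n) - 1) * (2 * \<delta> * (4 * (\<delta> + R) / \<kappa> + 1)) ^ CARD('n))"
    by (simp add: c_def)
qed

section \<open>Condensation of the divergent series\<close>

text \<open>
  The terms themselves need not decrease, so in each block from \<open>K ^ j\<close> to \<open>K ^ Suc j\<close> the factor with
  \<open>\<psi>\<close> is bounded by its value at the left end and the power of \<open>r\<close> by its value at the right end. This
  costs the constant factor \<open>K ^ d\<close>.
\<close>

lemma not_summable_condensed:
  fixes \<psi> :: "real \<Rightarrow> real" and K d n :: nat
  assumes pos: "\<And>x. 0 < x \<Longrightarrow> 0 \<le> \<psi> x" and dec: "\<And>x y. 0 < x \<Longrightarrow> x \<le> y \<Longrightarrow> \<psi> y \<le> \<psi> x"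
    and K: "2 \<le> K" and d: "1 \<le> d"
    and div: "\<not> summable (\<lambda>r. \<psi> (real (Suc r)) ^ n * real (Suc r) ^ (d - 1))"
  shows "\<not> summable (\<lambda>j. \<psi> (real K ^ j) ^ n * (real K ^ j) ^ d)"
proof
  define f where "f = (\<lambda>r::nat. \<psi> (real r) ^ n * real r ^ (d - 1))"
  define g where "g = (\<lambda>j. \<psi> (real K ^ j) ^ n * (real K ^ j) ^ d)"
  assume "summable (\<lambda>j. \<psi> (real K ^ j) ^ n * (real K ^ j) ^ d)"
  then have g: "summable g" by (simp add: g_def)
  have f0: "0 \<le> f r" if "1 \<le> r" for r using pos[of "real r"] that by (simp add: f_def)
  have g0: "0 \<le> g j" for j using pos[of "real K ^ j"] K by (simp add: g_def)
  have block: "(\<Sum>r\<in>{K ^ j..<K ^ Suc j}. f r) \<le> real K ^ d * g j" for j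
  proof -
    have "(\<Sum>r\<in>{K ^ j..<K ^ Suc j}. f r) \<le> (\<Sum>r\<in>{K ^ j..<K ^ Suc j}. \<psi> (real K ^ j) ^ n * (real K ^ Suc j) ^ (d - 1))"
    proof (rule sum_mono)
      fix r assume r: "r \<in> {K ^ j..<K ^ Suc j}"
      have Kj: "0 < real K ^ j" using K by simp
      have lo: "real K ^ j \<le> real r" using r of_nat_mono[of "K ^ j" r, where ?'a = real] by simp
      have hi: "real r \<le> real K ^ Suc j" using r of_nat_mono[of r "K ^ Suc j", where ?'a = real] by simp
      show "f r \<le> \<psi> (real K ^ j) ^ n * (real K ^ Suc j) ^ (d - 1)"
        unfolding f_def using dec[OF Kj lo] pos[of "real r"] pos[OF Kj] lo hi Kj
        by (intro mult_mono power_mono) auto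
    qed
    also have "\<dots> = real (K ^ Suc j - K ^ j) * (\<psi> (real K ^ j) ^ n * (real K ^ Suc j) ^ (d - 1))" by simp
    also have "\<dots> \<le> real K ^ Suc j * (\<psi> (real K ^ j) ^ n * (real K ^ Suc j) ^ (d - 1))"
    proof (rule mult_right_mono)
      have "real (K ^ Suc j - K ^ j) \<le> real (K ^ Suc j)" by (rule of_nat_mono) simp
      then show "real (K ^ Suc j - K ^ j) \<le> real K ^ Suc j" by simp
    qed (use pos[of "real K ^ j"] K in simp)
    also have "\<dots> = \<psi> (real K ^ j) ^ n * (real K ^ Suc j) ^ Suc (d - 1)" by simp
    also have "\<dots> = real K ^ d * g j" using d by (simp add: g_def power_mult_distrib)
    finally show ?thesis .
  qed
  have partial: "(\<Sum>r\<in>{1..<K ^ J}. f r) \<le> real K ^ d * (\<Sum>j<J. g j)" for J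
  proof (induction J)
    case (Suc J)
    have "(\<Sum>r\<in>{1..<K ^ Suc J}. f r) = (\<Sum>r\<in>{1..<K ^ J}. f r) + (\<Sum>r\<in>{K ^ J..<K ^ Suc J}. f r)"
      using K by (intro sum.atLeastLessThan_concat[symmetric]) auto
    also have "\<dots> \<le> real K ^ d * (\<Sum>j<J. g j) + real K ^ d * g J" using Suc block by (rule add_mono)
    finally show ?case by (simp add: algebra_simps)
  qed simp
  have "summable (\<lambda>r. f (Suc r))"
  proof (rule bounded_imp_summable)
    fix k
    have lt: "Suc (Suc k) \<le> K ^ Suc (Suc k)"
    proof -
      have "Suc (Suc k) \<le> 2 ^ Suc (Suc k)" by (rule less_imp_le[OF less_exp])
      also have "\<dots> \<le> K ^ Suc (Suc k)" using K by (intro power_mono) auto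
      finally show ?thesis .
    qed
    have "(\<Sum>r\<le>k. f (Suc r)) = (\<Sum>r\<in>{1..<Suc (Suc k)}. f r)"
      using sum.shift_bounds_Suc_ivl[of f 0 "Suc k"] by (simp add: atLeast0LessThan lessThan_Suc_atMost)
    also have "\<dots> \<le> (\<Sum>r\<in>{1..<K ^ Suc (Suc k)}. f r)" using lt f0 by (intro sum_mono2) auto
    also have "\<dots> \<le> real K ^ d * (\<Sum>j<Suc (Suc k). g j)" by (rule partial)
    also have "\<dots> \<le> real K ^ d * suminf g"
      using g g0 by (intro mult_left_mono sum_le_suminf) auto
    finally show "(\<Sum>r\<le>k. f (Suc r)) \<le> real K ^ d * suminf g" .
  qed (use f0 in auto)
  then show False using div by (simp add: f_def)
qed

text \<open>
  The ubiquity principle needs radii \<open>r\<^sub>j \<le> \<rho>\<^sub>j\<close>, which truncates the terms of the series at \<open>1\<close>.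
\<close>

lemma not_summable_min_one:
  fixes g :: "nat \<Rightarrow> real"
  assumes "\<not> summable g" "0 < c"
  shows "\<not> summable (\<lambda>j. min 1 (c * g j))"
proof
  assume s: "summable (\<lambda>j. min 1 (c * g j))"
  then have "\<forall>\<^sub>F j in sequentially. min 1 (c * g j) < 1"
    by (intro order_tendstoD(2)[OF summable_LIMSEQ_zero]) auto
  then have "\<forall>\<^sub>F j in sequentially. min 1 (c * g j) = c * g j" by eventually_elim auto
  then have "summable (\<lambda>j. min 1 (c * g j)) = summable (\<lambda>j. c * g j)" by (rule summable_cong)
  then have "summable (\<lambda>j. c * g j)" using s by simp
  then show False using assms by (simp add: summable_cmult_iff)
qed

section \<open>Approximable matrices\<close>

definition approximable :: "(real \<Rightarrow> real) \<Rightarrow> (real ^ 'n ^ 'm) set" where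
  "approximable \<psi> = {X. infinite {q. q \<noteq> 0 \<and> infnorm (real_vec q v* X) < \<psi> (real (height q))}}"

lemma approximable_iff:
  "X \<in> approximable \<psi> \<longleftrightarrow> (\<forall>k. \<exists>q. k < height q \<and> infnorm (real_vec q v* X) < \<psi> (real (height q)))"
proof
  assume inf: "X \<in> approximable \<psi>"
  show "\<forall>k. \<exists>q. k < height q \<and> infnorm (real_vec q v* X) < \<psi> (real (height q))"
  proof (rule allI, rule ccontr)
    fix k assume "\<not> (\<exists>q. k < height q \<and> infnorm (real_vec q v* X) < \<psi> (real (height q)))"
    then have "{q. q \<noteq> 0 \<and> infnorm (real_vec q v* X) < \<psi> (real (height q))} \<subseteq> {q. height q \<le> k}"
      by (auto simp: not_less)
    then show False using inf finite_subset[OF _ finite_height_le[of k]] by (auto simp: approximable_def)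
  qed
next
  assume *: "\<forall>k. \<exists>q. k < height q \<and> infnorm (real_vec q v* X) < \<psi> (real (height q))"
  let ?S = "{q. q \<noteq> 0 \<and> infnorm (real_vec q v* X) < \<psi> (real (height q))}"
  have "infinite ?S"
  proof
    assume fin: "finite ?S"
    obtain q where q: "(\<Sum>p\<in>?S. height p) < height q" "infnorm (real_vec q v* X) < \<psi> (real (height q))"
      using * by blast
    then have "q \<noteq> 0" using height_pos_iff[of q] by auto
    then have "q \<in> ?S" using q by simp
    then have "height q \<le> (\<Sum>p\<in>?S. height p)" using fin by (intro member_le_sum) auto
    then show False using q by simp
  qed
  then show "X \<in> approximable \<psi>" by (simp add: approximable_def)
qed

lemma approximable_borel [measurable]: "(approximable \<psi> :: (real ^ 'n ^ 'm) set) \<in> sets borel"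
proof -
  have "open {X :: real ^ 'n ^ 'm. infnorm (real_vec q v* X) < c}" for q c
    by (intro open_Collect_less continuous_on_real_vec_mult) auto
  then have "open (\<Union>q\<in>{q. k < height q}. {X :: real ^ 'n ^ 'm. infnorm (real_vec q v* X) < \<psi> (real (height q))})" for k
    by (intro open_UN) auto
  then have "(\<Inter>k. \<Union>q\<in>{q. k < height q}. {X :: real ^ 'n ^ 'm. infnorm (real_vec q v* X) < \<psi> (real (height q))}) \<in> sets borel"
    by (intro sets.countable_INT) auto
  also have "(\<Inter>k. \<Union>q\<in>{q. k < height q}. {X :: real ^ 'n ^ 'm. infnorm (real_vec q v* X) < \<psi> (real (height q))}) = approximable \<psi>"
    by (auto simp: approximable_iff)
  finally show ?thesis .
qed

section \<open>Full measure in the case of divergence\<close>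

text \<open>
  Ubiquity on a fibre. Since the proportion in \<open>measure_limsup_balls_ge\<close> depends on the dimension only,
  the parameter \<open>\<epsilon>\<close>, and with it the constant \<open>D\<close> in \<open>\<rho>\<^sub>j = D / 2\<^sup>j\<^sup>m\<close>, may depend on \<open>X\<close> and on the ball: it is
  chosen so that the rows with a small distinguished coordinate fill at most half of the inner ball.
\<close>

lemma fibre_lower_density:
  fixes X :: "real ^ 'n ^ 'm" and \<psi> :: "real \<Rightarrow> real"
  assumes mn: "CARD('n) < CARD('m)"
    and pos: "\<And>x. 0 < x \<Longrightarrow> 0 < \<psi> x" and dec: "\<And>x y. 0 < x \<Longrightarrow> x \<le> y \<Longrightarrow> \<psi> y \<le> \<psi> x"
    and div: "\<not> summable (\<lambda>r. \<psi> (real (Suc r)) ^ CARD('n) * real (Suc r) ^ (CARD('m) - CARD('n) - 1))"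
    and \<sigma>: "inj \<sigma>" "a \<notin> range \<sigma>" and det: "det (row_block \<sigma> X) \<noteq> 0"
    and avoid: "\<forall>k::nat. \<forall>\<^sub>F j in sequentially.
      \<forall>q. q \<noteq> 0 \<longrightarrow> q $ a = 0 \<longrightarrow> height q \<le> (2 ^ j) ^ CARD('n) \<longrightarrow>
        real k * (2 ^ j) ^ CARD('n) / (2 ^ j) ^ CARD('m) < infnorm (real_vec q v* X)"
    and R: "0 < R"
  shows "ubiquity_const CARD('n) * measure lborel (ball y0 R)
      \<le> measure lborel ({y. X + axis a y \<in> approximable \<psi>} \<inter> ball y0 R)"
proof -
  define m n where "m = CARD('m)" and "n = CARD('n)"
  have mn': "0 < n" "n < m" using mn by (auto simp: m_def n_def)
  obtain \<kappa> where \<kappa>: "0 < \<kappa>" "\<And>u. \<kappa> * infnorm u \<le> infnorm (u v* row_block \<sigma> X)"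
    using nonsingular_infnorm_lower_bound[OF det] by blast
  obtain A :: nat where A: "norm X + norm y0 + R < real A" using reals_Archimedean2 by blast
  have entries: "\<bar>(X + axis a y) $ i $ j\<bar> < real A" if "y \<in> ball y0 R" for y i j
  proof -
    have "norm y \<le> norm y0 + dist y0 y" using norm_triangle_ineq4[of y0 "y0 - y"] by (simp add: dist_norm)
    then have "norm y < norm y0 + R" using that by simp
    moreover have "\<bar>axis a y $ i $ j\<bar> \<le> norm y" using component_le_norm_cart[of y j] by (simp add: axis_def)
    moreover have "\<bar>X $ i $ j\<bar> \<le> norm X"
      using component_le_norm_cart[of "X $ i" j] Finite_Cartesian_Product.norm_nth_le[of X i] by simp
    ultimately show ?thesis using A by simp
  qed
  have A0: "0 < A" using A R norm_ge_zero[of X] norm_ge_zero[of y0] by (intro gr0I) simp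
  \<comment> \<open>The pigeonhole principle gives forms of size at most \<open>\<delta> j\<close> for all rows of the ball.\<close>
  define K where "K = 2 * m * A"
  have K: "0 < real K" using A0 mn' by (simp add: K_def)
  define \<delta> where "\<delta> = (\<lambda>j. real K * (2 ^ j) ^ n / (2 ^ j) ^ m)"
  have \<delta>0: "0 < \<delta> j" for j using K by (simp add: \<delta>_def)
  have \<delta>K: "\<delta> j \<le> real K" for j
  proof -
    have "((2::real) ^ j) ^ n \<le> (2 ^ j) ^ m" using mn' by (intro power_increasing) auto
    then show ?thesis using K by (simp add: \<delta>_def divide_le_eq)
  qed
  define \<beta> where "\<beta> = 4 * (real K + R / 2) / \<kappa> + 1"
  have \<beta>: "0 < \<beta>" using K R \<kappa>(1) by (simp add: \<beta>_def add_pos_pos)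
  \<comment> \<open>The rows with a small distinguished coordinate turn out to have measure at most \<open>\<epsilon> * C\<close> at
    every level, because the powers of \<open>N j\<close> cancel.\<close>
  define C where "C = 2 * 3 ^ m * (2 * real K * \<beta>) ^ n"
  have C: "0 < C" using K \<beta> by (simp add: C_def)
  define vol where "vol = measure lborel (ball y0 (R / 2))"
  have vol: "0 < vol" using R by (simp add: vol_def content_ball_pos)
  define \<epsilon> where "\<epsilon> = vol / (2 * C)"
  have \<epsilon>: "0 < \<epsilon>" using vol C by (simp add: \<epsilon>_def)
  define N :: "nat \<Rightarrow> nat" where "N = (\<lambda>j. (2 ^ j) ^ n)"
  have N1: "1 \<le> N j" for j by (simp add: N_def)
  define P where "P = (\<lambda>j. (\<lambda>q. - (1 / real_of_int (q $ a)) *\<^sub>R (real_vec q v* X)) `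
      {q. height q \<le> N j \<and> \<epsilon> * real (N j) < \<bar>real_of_int (q $ a)\<bar>})"
  define \<rho> where "\<rho> = (\<lambda>j. sqrt (real n) * \<delta> j / (\<epsilon> * real (N j)))"
  define D where "D = sqrt (real n) * real K / \<epsilon>"
  have D: "0 < D" using mn' K \<epsilon> by (simp add: D_def)
  have \<rho>_eq: "\<rho> j = D / (2 ^ j) ^ m" for j
    by (simp add: \<rho>_def \<delta>_def N_def D_def)
  define r where "r = (\<lambda>j. min (\<rho> j) (\<psi> (real (N j)) / real (N j)))"
  have \<rho>0: "0 < \<rho> j" for j using D by (simp add: \<rho>_eq)
  have bad: "small_coordinate_set X a y0 (R / 2) \<epsilon> (N j) (\<delta> j) \<in> fmeasurable lborel"
    "measure lborel (small_coordinate_set X a y0 (R / 2) \<epsilon> (N j) (\<delta> j)) \<le> vol / 2" for j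
  proof -
    let ?S = "small_coordinate_set X a y0 (R / 2) \<epsilon> (N j) (\<delta> j)"
    have pre: "0 \<le> \<delta> j" "0 \<le> R / 2" "0 \<le> \<epsilon>" "1 \<le> N j" using \<delta>0[of j] R \<epsilon> N1[of j] by auto
    show "?S \<in> fmeasurable lborel" by (rule measure_small_coordinate_set_le(1)[OF \<sigma> \<kappa> pre])
    have "measure lborel ?S \<le> 2 * \<epsilon> * real (N j) * ((3 * real (N j)) ^ (m - n - 1) * (2 * \<delta> j * (4 * (\<delta> j + R / 2) / \<kappa> + 1)) ^ n)"
      unfolding m_def n_def by (rule measure_small_coordinate_set_le(2)[OF \<sigma> \<kappa> pre])
    also have "\<dots> \<le> 2 * \<epsilon> * real (N j) * ((3 * real (N j)) ^ (m - n - 1) * (2 * \<delta> j * \<beta>) ^ n)"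
    proof (intro mult_left_mono power_mono)
      show "4 * (\<delta> j + R / 2) / \<kappa> + 1 \<le> \<beta>"
        unfolding \<beta>_def using \<delta>K[of j] \<kappa>(1) by (intro add_mono divide_right_mono mult_left_mono) auto
    qed (use \<delta>0[of j] R \<epsilon> \<kappa>(1) in auto)
    also have "\<dots> = 2 * \<epsilon> * 3 ^ (m - n - 1) * (2 * real K * \<beta>) ^ n * (real (N j) * real (N j) ^ (m - n - 1) * (((2 ^ j) ^ n / (2 ^ j) ^ m) ^ n))"
      by (simp add: \<delta>_def power_mult_distrib power_divide)
    also have "real (N j) * real (N j) ^ (m - n - 1) * (((2 ^ j) ^ n / (2 ^ j) ^ m) ^ n) = 1"
    proof -
      have "real (N j) * real (N j) ^ (m - n - 1) = real (N j) ^ Suc (m - n - 1)" by simp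
      also have "Suc (m - n - 1) = m - n" using mn' by simp
      finally have "real (N j) * real (N j) ^ (m - n - 1) * (((2 ^ j) ^ n) ^ n) = real (N j) ^ (m - n) * real (N j) ^ n"
        by (simp add: N_def)
      also have "\<dots> = real (N j) ^ m" using mn' by (simp add: power_add[symmetric])
      also have "\<dots> = ((2 ^ j) ^ m) ^ n" by (simp add: N_def power_mult[symmetric] mult.commute mult.left_commute)
      finally show ?thesis by (simp add: power_divide)
    qed
    also have "2 * \<epsilon> * 3 ^ (m - n - 1) * (2 * real K * \<beta>) ^ n * 1 \<le> 2 * \<epsilon> * 3 ^ m * (2 * real K * \<beta>) ^ n * 1"
      using \<epsilon> K \<beta> by (intro mult_right_mono mult_left_mono power_increasing) auto
    also have "\<dots> = \<epsilon> * C" by (simp add: C_def)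
    also have "\<dots> = vol / 2" using C by (simp add: \<epsilon>_def)
    finally show "measure lborel ?S \<le> vol / 2" .
  qed
  have countP: "countable (P j)" for j
    unfolding P_def
    by (intro countable_image countable_finite finite_subset[OF _ finite_height_le[of "N j"]]) auto
  have cov: "\<forall>\<^sub>F j in sequentially. measure lborel (ball y0 (R/2)) / 2
       \<le> measure lborel (ball y0 (R/2) \<inter> (\<Union>p\<in>P j. cball p (\<rho> j)))"
    using avoid[rule_format, of K]
  proof eventually_elim
    case (elim j)
    let ?S = "small_coordinate_set X a y0 (R / 2) \<epsilon> (N j) (\<delta> j)"
    let ?G = "ball y0 (R/2) \<inter> (\<Union>p\<in>P j. cball p (\<rho> j))"
    have G: "?G \<in> fmeasurable lborel"
      using countP[of j] by (intro fmeasurable_Int_fmeasurable sets.countable_UN') auto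
    have sub: "ball y0 (R/2) \<subseteq> ?G \<union> ?S"
    proof
      fix y assume y: "y \<in> ball y0 (R/2)"
      then have yR: "y \<in> ball y0 R" using R by simp
      obtain q where q: "q \<noteq> 0" "height q \<le> (2 ^ j) ^ n"
        "infnorm (real_vec q v* (X + axis a y)) \<le> 2 * real m * real A * real (2 ^ j) ^ n / real (2 ^ j) ^ m"
        using exists_short_form[OF entries[OF yR], of "2 ^ j"] unfolding n_def m_def by auto
      define s where "s = real_of_int (q $ a)"
      have q3: "infnorm (real_vec q v* X + s *\<^sub>R y) \<le> \<delta> j"
        using q(3) by (simp add: real_vec_mult_add_axis \<delta>_def K_def s_def)
      have qa: "q $ a \<noteq> 0"
      proof
        assume "q $ a = 0"
        then have "\<delta> j < infnorm (real_vec q v* X)"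
          using elim q(1,2) by (simp add: \<delta>_def m_def n_def)
        then show False using q3 \<open>q $ a = 0\<close> by (simp add: s_def)
      qed
      then have s0: "s \<noteq> 0" by (simp add: s_def)
      show "y \<in> ?G \<union> ?S"
      proof (cases "\<epsilon> * real (N j) < \<bar>s\<bar>")
        case True
        define p where "p = - (1 / s) *\<^sub>R (real_vec q v* X)"
        have pP: "p \<in> P j" unfolding P_def p_def s_def
          using True q(2) by (intro imageI) (simp add: s_def N_def)
        have "y - p = (1 / s) *\<^sub>R (real_vec q v* X + s *\<^sub>R y)"
          using s0 by (simp add: p_def scaleR_add_right)
        then have "norm (y - p) = norm (real_vec q v* X + s *\<^sub>R y) / \<bar>s\<bar>" by simp
        also have "\<dots> \<le> sqrt (real n) * \<delta> j / \<bar>s\<bar>"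
        proof (rule divide_right_mono)
          have "norm (real_vec q v* X + s *\<^sub>R y) \<le> sqrt (real n) * infnorm (real_vec q v* X + s *\<^sub>R y)"
            using norm_le_infnorm[of "real_vec q v* X + s *\<^sub>R y"] by (simp add: n_def)
          also have "\<dots> \<le> sqrt (real n) * \<delta> j" using q3 by (intro mult_left_mono) auto
          finally show "norm (real_vec q v* X + s *\<^sub>R y) \<le> sqrt (real n) * \<delta> j" .
        qed simp
        also have "\<dots> \<le> \<rho> j"
          unfolding \<rho>_def using True \<epsilon> N1[of j] \<delta>0[of j] s0 by (intro divide_left_mono mult_pos_pos) auto
        finally have "y \<in> cball p (\<rho> j)" by (simp add: dist_norm norm_minus_commute)
        then show ?thesis using y pP by blast
      next
        case False
        have "infnorm (real_vec q v* X + s *\<^sub>R y0) \<le> infnorm (real_vec q v* X + s *\<^sub>R y) + infnorm (s *\<^sub>R (y0 - y))"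
          using infnorm_triangle[of "real_vec q v* X + s *\<^sub>R y" "s *\<^sub>R (y0 - y)"]
          by (simp add: algebra_simps)
        also have "infnorm (s *\<^sub>R (y0 - y)) \<le> \<bar>s\<bar> * (R / 2)"
        proof -
          have "infnorm (y0 - y) \<le> R / 2"
            using infnorm_le_norm[of "y0 - y"] y by (simp add: dist_norm)
          then show ?thesis unfolding infnorm_mul by (rule mult_left_mono) simp
        qed
        finally have "infnorm (real_vec q v* X + s *\<^sub>R y0) \<le> \<delta> j + \<bar>s\<bar> * (R / 2)" using q3 by simp
        then have "y \<in> ?S"
          unfolding small_coordinate_set_def using qa q(2) False q3
          by (intro UN_I[of q]) (simp_all add: s_def N_def)
        then show ?thesis by simp
      qed
    qed
    have "vol \<le> measure lborel (?G \<union> ?S)"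
      unfolding vol_def using G bad(1)[of j]
      by (intro measure_mono_fmeasurable[OF sub] fmeasurable.Un) auto
    also have "\<dots> \<le> measure lborel ?G + measure lborel ?S"
      using G bad(1)[of j] by (intro measure_Un_le fmeasurableD) auto
    also have "\<dots> \<le> measure lborel ?G + vol / 2" using bad(2)[of j] by simp
    finally show ?case by (simp add: vol_def)
  qed
  have ratio: "(r j / \<rho> j) ^ n = min 1 ((1 / D) ^ n * (\<psi> (real (2 ^ n) ^ j) ^ n * (real (2 ^ n) ^ j) ^ (m - n)))" for j
  proof -
    define x where "x = \<psi> (real (N j)) / (real (N j) * \<rho> j)"
    have x: "0 \<le> x" using pos[of "real (N j)"] N1[of j] \<rho>0[of j] by (simp add: x_def)
    have "r j / \<rho> j = min 1 x"
      using \<rho>0[of j] by (simp add: r_def min_divide_distrib_right x_def)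
    then have "(r j / \<rho> j) ^ n = min 1 (x ^ n)"
    proof (cases "x \<le> 1")
      case True
      then show ?thesis using x \<open>r j / \<rho> j = min 1 x\<close> power_le_one[OF x True, of n] by simp
    next
      case False
      then show ?thesis using \<open>r j / \<rho> j = min 1 x\<close> one_le_power[of x n] by simp
    qed
    also have "x ^ n = (1 / D) ^ n * (\<psi> (real (N j)) ^ n * real (N j) ^ (m - n))"
    proof -
      have "x = (1 / D) * (\<psi> (real (N j)) * ((2 ^ j) ^ m / real (N j)))"
        using D by (simp add: x_def \<rho>_eq field_simps)
      then have "x ^ n = (1 / D) ^ n * (\<psi> (real (N j)) ^ n * (((2 ^ j) ^ m) ^ n / real (N j) ^ n))"
        by (simp add: power_mult_distrib power_divide)
      also have "((2 ^ j) ^ m) ^ n = real (N j) ^ m"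
        by (simp add: N_def power_mult[symmetric] mult.commute mult.left_commute)
      also have "real (N j) ^ m / real (N j) ^ n = real (N j) ^ (m - n)"
        using mn' N1[of j] by (simp add: power_diff)
      finally show ?thesis .
    qed
    also have "real (N j) = real (2 ^ n) ^ j"
      by (simp add: N_def power_mult[symmetric] mult.commute)
    finally show ?thesis .
  qed
  have "\<not> summable (\<lambda>j. \<psi> (real (2 ^ n) ^ j) ^ n * (real (2 ^ n) ^ j) ^ (m - n))"
  proof (rule not_summable_condensed)
    show "(2::nat) \<le> 2 ^ n" using mn' self_le_power[of "2::nat" n] by simp
    show "\<not> summable (\<lambda>r. \<psi> (real (Suc r)) ^ n * real (Suc r) ^ (m - n - 1))"
      using div unfolding m_def n_def .
  qed (use pos dec mn' in \<open>auto intro: less_imp_le\<close>)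
  then have divr: "\<not> summable (\<lambda>j. (r j / \<rho> j) ^ DIM(real ^ 'n))"
    using not_summable_min_one[of _ "(1 / D) ^ n"] D ratio by (simp add: n_def)
  have "ubiquity_const DIM(real ^ 'n) * measure lborel (ball y0 R)
     \<le> measure lborel (ball y0 R \<inter> {x. \<exists>\<^sub>F j in sequentially. \<exists>p\<in>P j. x \<in> ball p (r j)})"
  proof (rule measure_limsup_balls_ge[OF countP R _ _ _ _ divr cov])
    show "0 < \<rho> j" for j by (rule \<rho>0)
    show "\<rho> (Suc j) \<le> \<rho> j / 2" for j
    proof -
      have "(2::real) ^ 1 \<le> 2 ^ m" using mn' by (intro power_increasing) auto
      then have "D / (2 ^ j) ^ m / 2 ^ m \<le> D / (2 ^ j) ^ m / 2"
        using D by (intro divide_left_mono) auto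
      then show ?thesis by (simp add: \<rho>_eq power_mult_distrib mult.commute)
    qed
    show "0 < r j" for j using \<rho>0[of j] pos[of "real (N j)"] N1[of j] by (simp add: r_def)
    show "r j \<le> \<rho> j" for j by (simp add: r_def)
  qed
  also have "\<dots> \<le> measure lborel ({y. X + axis a y \<in> approximable \<psi>} \<inter> ball y0 R)"
  proof (rule measure_mono_fmeasurable)
    show "ball y0 R \<inter> {x. \<exists>\<^sub>F j in sequentially. \<exists>p\<in>P j. x \<in> ball p (r j)}
       \<subseteq> {y. X + axis a y \<in> approximable \<psi>} \<inter> ball y0 R"
    proof
      fix y assume y: "y \<in> ball y0 R \<inter> {x. \<exists>\<^sub>F j in sequentially. \<exists>p\<in>P j. x \<in> ball p (r j)}"
      have "\<exists>q. k < height q \<and> infnorm (real_vec q v* (X + axis a y)) < \<psi> (real (height q))" for k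
      proof -
        obtain j0 :: nat where j0: "real k / \<epsilon> < real j0" using reals_Archimedean2 by blast
        obtain j p where j: "j \<ge> j0" "p \<in> P j" "y \<in> ball p (r j)"
          using y unfolding frequently_sequentially by blast
        obtain q where q: "p = - (1 / real_of_int (q $ a)) *\<^sub>R (real_vec q v* X)" "height q \<le> N j"
           "\<epsilon> * real (N j) < \<bar>real_of_int (q $ a)\<bar>" using j(2) by (auto simp: P_def)
        define s where "s = real_of_int (q $ a)"
        have sh: "\<bar>s\<bar> \<le> real (height q)"
          using abs_le_height[of q a] unfolding s_def by linarith
        have "real j0 \<le> real (N j)"
        proof -
          have "j \<le> 2 ^ j" by (rule less_imp_le[OF less_exp])
          also have "(2::nat) ^ j \<le> (2 ^ j) ^ n" using mn' by (intro self_le_power) auto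
          finally have "j \<le> N j" unfolding N_def .
          then show ?thesis using j(1) by simp
        qed
        then have "\<epsilon> * real j0 \<le> \<epsilon> * real (N j)" using \<epsilon> by (intro mult_left_mono) auto
        moreover have "real k < \<epsilon> * real j0"
          using j0 \<epsilon> by (simp add: pos_divide_less_eq mult.commute)
        ultimately have "real k < \<epsilon> * real (N j)" by simp
        then have ks: "real k < \<bar>s\<bar>" using q(3) by (simp add: s_def)
        then have kh: "k < height q" using sh by simp
        have s0: "0 < \<bar>s\<bar>" using ks by simp
        have "real_vec q v* (X + axis a y) = s *\<^sub>R (y - p)"
          using s0 by (simp add: real_vec_mult_add_axis q(1) s_def scaleR_add_right)
        then have "infnorm (real_vec q v* (X + axis a y)) \<le> \<bar>s\<bar> * norm (y - p)"
          by (simp only: infnorm_mul) (intro mult_left_mono infnorm_le_norm abs_ge_zero)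
        also have "\<dots> < \<bar>s\<bar> * (\<psi> (real (N j)) / real (N j))"
          using s0 j(3) by (intro mult_strict_left_mono) (auto simp: r_def dist_norm norm_minus_commute)
        also have "\<dots> \<le> real (N j) * (\<psi> (real (N j)) / real (N j))"
          using sh q(2) pos[of "real (N j)"] N1[of j] by (intro mult_right_mono) auto
        also have "\<dots> = \<psi> (real (N j))" using N1[of j] by simp
        also have "\<dots> \<le> \<psi> (real (height q))" using q(2) kh by (intro dec) auto
        finally show ?thesis using kh by blast
      qed
      then show "y \<in> {y. X + axis a y \<in> approximable \<psi>} \<inter> ball y0 R"
        using y by (simp add: approximable_iff)
    qed
    have lim: "{x. \<exists>\<^sub>F j in sequentially. \<exists>p\<in>P j. x \<in> ball p (r j)}
        = (\<Inter>J. \<Union>j\<in>{J..}. \<Union>p\<in>P j. ball p (r j))"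
      unfolding frequently_sequentially by blast
    have "open (\<Union>j\<in>{J..}. \<Union>p\<in>P j. ball p (r j))" for J by (intro open_UN ballI open_ball)
    then show "ball y0 R \<inter> {x. \<exists>\<^sub>F j in sequentially. \<exists>p\<in>P j. x \<in> ball p (r j)} \<in> sets lborel"
      unfolding lim by (intro sets.Int sets.countable_INT) auto
    have "{y. X + axis a y \<in> approximable \<psi>} \<in> sets borel" by measurable
    then show "{y. X + axis a y \<in> approximable \<psi>} \<inter> ball y0 R \<in> fmeasurable lborel"
      by (subst Int_commute, intro fmeasurable_Int_fmeasurable) auto
  qed
  finally show ?thesis by simp
qed

lemma AE_approximable:
  assumes mn: "CARD('n::finite) < CARD('m::finite)"
    and pos: "\<And>x. 0 < x \<Longrightarrow> 0 < \<psi> x" and dec: "\<And>x y. 0 < x \<Longrightarrow> x \<le> y \<Longrightarrow> \<psi> y \<le> \<psi> x"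
    and div: "\<not> summable (\<lambda>r. \<psi> (real (Suc r)) ^ CARD('n) * real (Suc r) ^ (CARD('m) - CARD('n) - 1))"
  shows "AE X :: real ^ 'n ^ 'm in lborel. X \<in> approximable \<psi>"
proof -
  \<comment> \<open>As m > n, there are n frozen rows besides the varying row a.\<close>
  obtain \<sigma> :: "'n \<Rightarrow> 'm" where \<sigma>: "inj \<sigma>"
    using card_le_inj[of "UNIV :: 'n set" "UNIV :: 'm set"] mn by auto
  have "range \<sigma> \<noteq> UNIV"
  proof
    assume "range \<sigma> = UNIV"
    then have "CARD('m) = CARD('n)" using card_image[OF \<sigma>] by simp
    then show False using mn by simp
  qed
  then obtain a where a: "a \<notin> range \<sigma>" by auto
  show ?thesis
  proof (rule AE_of_AE_translates[where g = "axis a"])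
    show "{X :: real ^ 'n ^ 'm. X \<in> approximable \<psi>} \<in> sets borel" by simp
    show "(axis a :: real ^ 'n \<Rightarrow> real ^ 'n ^ 'm) \<in> borel_measurable borel" by (rule borel_measurable_axis)
    show "AE X :: real ^ 'n ^ 'm in lborel. AE y in lborel. X + axis a y \<in> approximable \<psi>"
      using AE_row_block_nonsingular[OF \<sigma>] AE_no_short_forms_avoiding_coordinate[OF mn, of a]
    proof eventually_elim
      fix X :: "real ^ 'n ^ 'm"
      assume X: "det (row_block \<sigma> X) \<noteq> 0" "\<forall>k::nat. \<forall>\<^sub>F j in sequentially.
        \<forall>q. q \<noteq> 0 \<longrightarrow> q $ a = 0 \<longrightarrow> height q \<le> (2 ^ j) ^ CARD('n) \<longrightarrow>
        real k * (2 ^ j) ^ CARD('n) / (2 ^ j) ^ CARD('m) < infnorm (real_vec q v* X)"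
      have "AE y in lborel. y \<in> {y. X + axis a y \<in> approximable \<psi>}"
      proof (rule AE_of_uniform_lower_density)
        show "{y. X + axis a y \<in> approximable \<psi>} \<in> sets borel" by measurable
        show "ubiquity_const CARD('n) > 0" by (rule ubiquity_const_pos)
        show "ubiquity_const CARD('n) * measure lborel (ball y0 R)
          \<le> measure lborel ({y. X + axis a y \<in> approximable \<psi>} \<inter> ball y0 R)" if "0 < R" for y0 R
          by (rule fibre_lower_density[OF mn pos dec div \<sigma> a X that])
      qed
      then show "AE y in lborel. X + axis a y \<in> approximable \<psi>" by simp
    qed
  qed
qed

lemma W0_eq: "W0 \<psi> = unit_cube \<inter> approximable \<psi>"
  by (auto simp: W0_def approximable_def infnorm_real_vec)

lemma emeasure_unit_cube: "emeasure lborel (unit_cube :: (real ^ 'n ^ 'm) set) = 1"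
proof -
  let ?h = "(\<chi> i j. 1/2) :: real ^ 'n ^ 'm"
  have h: "?h \<bullet> b = 1/2" if "b \<in> Basis" for b
    using that by (auto simp: Basis_vec_def inner_axis)
  have "unit_cube = cbox (- ?h) ?h"
  proof (intro set_eqI)
    fix X :: "real ^ 'n ^ 'm"
    have "X \<in> cbox (- ?h) ?h \<longleftrightarrow> (\<forall>i j. - (1/2) \<le> X $ i $ j \<and> X $ i $ j \<le> 1/2)"
      using h by (auto simp: mem_box Basis_vec_def inner_axis)
    then show "X \<in> unit_cube \<longleftrightarrow> X \<in> cbox (- ?h) ?h" by (simp add: unit_cube_def)
  qed
  moreover have "emeasure lborel (cbox (- ?h) ?h) = 1"
  proof (subst emeasure_lborel_cbox)
    have "(\<Prod>b\<in>Basis. (?h - - ?h) \<bullet> b) = 1"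
    proof (intro prod.neutral ballI)
      fix b :: "real ^ 'n ^ 'm" assume b: "b \<in> Basis"
      show "(?h - - ?h) \<bullet> b = 1" unfolding inner_diff_left inner_minus_left h[OF b] by simp
    qed
    then show "ennreal (\<Prod>b\<in>Basis. (?h - - ?h) \<bullet> b) = 1" by simp
    show "- ?h \<bullet> b \<le> ?h \<bullet> b" if "b \<in> Basis" for b
      using h[OF that] by (simp add: inner_minus_left)
  qed
  ultimately show ?thesis by simp
qed

theorem corollary1:
  fixes \<psi> :: "real \<Rightarrow> real"
  assumes "CARD('m::finite) > CARD('n::finite)"
    and "approximating_function \<psi>"
  shows "(summable (\<lambda>r. \<psi> (real (Suc r)) ^ CARD('n) * real (Suc r) ^ (CARD('m) - CARD('n) - 1))
            \<longrightarrow> emeasure lebesgue (W0 \<psi> :: (real ^ 'n ^ 'm) set) = 0)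
       \<and> (\<not> summable (\<lambda>r. \<psi> (real (Suc r)) ^ CARD('n) * real (Suc r) ^ (CARD('m) - CARD('n) - 1))
            \<longrightarrow> emeasure lebesgue (W0 \<psi> :: (real ^ 'n ^ 'm) set) = 1)"
proof -
  have pos: "0 < \<psi> x" if "0 < x" for x using assms(2) that by (simp add: approximating_function_def)
  have dec: "\<psi> y \<le> \<psi> x" if "0 < x" "x \<le> y" for x y
  proof -
    have "antimono_on {0<..} \<psi>" using assms(2) unfolding approximating_function_def by blast
    from monotone_onD[OF this, of x y] show ?thesis using that by simp
  qed
  have cube: "(unit_cube :: (real ^ 'n ^ 'm) set) \<in> sets borel"
    unfolding unit_cube_def atLeastAtMost_iff
    by (intro borel_closed closed_Collect_all closed_Collect_conj closed_Collect_le continuous_intros)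
  have W: "(W0 \<psi> :: (real ^ 'n ^ 'm) set) \<in> sets borel"
    unfolding W0_eq using cube by simp
  have leb: "emeasure lebesgue (W0 \<psi> :: (real ^ 'n ^ 'm) set) = emeasure lborel (W0 \<psi> :: (real ^ 'n ^ 'm) set)"
    using W by simp
  show ?thesis
  proof (intro conjI impI)
    assume sum: "summable (\<lambda>r. \<psi> (real (Suc r)) ^ CARD('n) * real (Suc r) ^ (CARD('m) - CARD('n) - 1))"
    have "AE X :: real ^ 'n ^ 'm in lborel. finite {q. q \<noteq> 0 \<and> infnorm (real_vec q v* X) \<le> \<psi> (real (height q))}"
      using pos by (intro AE_finitely_many_of_summable[OF assms(1) _ sum]) (simp add: less_imp_le)
    then have "AE X :: real ^ 'n ^ 'm in lborel. X \<notin> W0 \<psi>"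
    proof eventually_elim
      fix X :: "real ^ 'n ^ 'm" assume "finite {q. q \<noteq> 0 \<and> infnorm (real_vec q v* X) \<le> \<psi> (real (height q))}"
      then have "finite {q. q \<noteq> 0 \<and> infnorm (real_vec q v* X) < \<psi> (real (height q))}"
        by (rule finite_subset[rotated]) auto
      then show "X \<notin> W0 \<psi>" by (simp add: W0_eq approximable_def)
    qed
    then have "emeasure lborel (W0 \<psi> :: (real ^ 'n ^ 'm) set) = 0"
      using W by (subst (asm) AE_iff_measurable[where N = "W0 \<psi>"]) auto
    then show "emeasure lebesgue (W0 \<psi> :: (real ^ 'n ^ 'm) set) = 0" by (simp only: leb)
  next
    assume div: "\<not> summable (\<lambda>r. \<psi> (real (Suc r)) ^ CARD('n) * real (Suc r) ^ (CARD('m) - CARD('n) - 1))"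
    have "AE X :: real ^ 'n ^ 'm in lborel. X \<in> approximable \<psi>"
      by (rule AE_approximable[OF assms(1) pos dec div])
    then have "AE X :: real ^ 'n ^ 'm in lborel. X \<in> W0 \<psi> \<longleftrightarrow> X \<in> unit_cube"
      by eventually_elim (simp add: W0_eq)
    then have "emeasure lborel (W0 \<psi> :: (real ^ 'n ^ 'm) set) = emeasure lborel (unit_cube :: (real ^ 'n ^ 'm) set)"
      using W cube by (intro emeasure_eq_AE) auto
    then show "emeasure lebesgue (W0 \<psi> :: (real ^ 'n ^ 'm) set) = 1"
      by (simp only: leb emeasure_unit_cube)
  qed
qed

end
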